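(* Let $X\subset\mathbb{R}^n$ be closed, bounded and convex. Let $F(x)=\mathbb{E}[\Phi(x,\xi)]$ be monotone and continuous on $X^\epsilon$, suppose there is $C>0$ with $\mathbb{E}[\|\Phi(x,\xi)\|^2]\le C^2$ for all $x\in X^\epsilon$, and suppose the solution set $X^*$ of VI$(X,F)$ is nonempty. Let $t^*$ be the least-norm solution of VI$(X,F)$, and assume that $F$ is differentiable at $t^*$ and its Jacobian is bounded in a neighborhood of $t^*$. Let $\gamma_k=\gamma_0(k+1)^{-a}$, $\eta_k=\eta_0(k+1)^{-b}$, $\epsilon_k=\epsilon_0(k+1)^{-c}$ with positive constants $\gamma_0,\eta_0,\epsilon_0$, and suppose $$a,b,c>0,\quad a>0.5,\quad a+3b<1,\quad b+2c<a,\quad b<c,\quad r\le\frac1a.$$ Let $\xi_0,\xi_1,\dots$ be i.i.d. copies of $\xi$, let $z_0,z_1,\dots$ be independent with $z_k$ uniform on $B_n(0,\epsilon_k)$, and let $x_0$, $(\xi_j)$, $(z_i)$ be mutually independent. Let $\{\bar x_k(r)\}$ be generated by the aRSSA$_r$ algorithm. Then, almost surely, $\lim_{k\to\infty}\bar x_k(r)=t^*$.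
   Context: $\|\cdot\|$ is the Euclidean norm, $B_n(y,\rho)=\{x\in\mathbb{R}^n:\|x-y\|\le\rho\}$, $\Pi_X$ is Euclidean projection onto $X$. $\epsilon>0$ is a fixed upper bound of $\{\epsilon_k\}$ and $X^\epsilon=X+B_n(0,\epsilon)$. $\xi$ is an $\mathbb{R}^d$-valued random vector, $\Phi:X^\epsilon\times\mathbb{R}^d\to\mathbb{R}^n$. VI$(X,F)$ asks for $x^*\in X$ with $F(x^* )^T(x-x^* )\ge0$ for all $x\in X$. aRSSA$_r$ algorithm ($r\in\mathbb{R}$): $x_0\in X$ is a random vector with $\mathbb{E}[\|x_0\|^2]<\infty$, and for $k\ge0$, $x_{k+1}=\Pi_X\big(x_k-\gamma_k(\Phi(x_k+z_k,\xi_k)+\eta_kx_k)\big)$, $\ \bar x_{k+1}(r)=\frac{\sum_{t=0}^k\gamma_t^rx_t}{\sum_{t=0}^k\gamma_t^r}$. *)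

theory Defs
  imports "HOL-Analysis.Analysis" "HOL-Probability.Probability"
begin

definition VI_solutions :: "'a::real_inner set \<Rightarrow> ('a \<Rightarrow> 'a) \<Rightarrow> 'a set" where
  "VI_solutions X F = {s \<in> X. \<forall>x\<in>X. 0 \<le> F s \<bullet> (x - s)}"

definition monotone_map_on :: "'a::real_inner set \<Rightarrow> ('a \<Rightarrow> 'a) \<Rightarrow> bool" where
  "monotone_map_on S F \<longleftrightarrow> (\<forall>x\<in>S. \<forall>y\<in>S. 0 \<le> (F x - F y) \<bullet> (x - y))"

text \<open>
  The library constant \<open>indep_vars\<close> requires all variables of a family to take values in one type.
  The following is its definition spelled out for three variables with values in different types.
\<close>

definition indep_vars3 ::
  "'w measure \<Rightarrow> 'a measure \<Rightarrow> ('w \<Rightarrow> 'a) \<Rightarrow> 'b measure \<Rightarrow> ('w \<Rightarrow> 'b) \<Rightarrow>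
    'c measure \<Rightarrow> ('w \<Rightarrow> 'c) \<Rightarrow> bool" where
  "indep_vars3 M N1 X1 N2 X2 N3 X3 \<longleftrightarrow>
     X1 \<in> measurable M N1 \<and> X2 \<in> measurable M N2 \<and> X3 \<in> measurable M N3 \<and>
     prob_space.indep_sets M
       (\<lambda>i. [{X1 -` A \<inter> space M |A. A \<in> sets N1},
             {X2 -` A \<inter> space M |A. A \<in> sets N2},
             {X3 -` A \<inter> space M |A. A \<in> sets N3}] ! i) {..<3}"

text \<open>
  The iterates are defined along one realisation: \<open>x0\<close>, \<open>z\<close> and \<open>xi\<close> are the values of the
  random initial point, the perturbations and the samples. The function \<open>closest_point X\<close> is the
  Euclidean projection onto the closed convex set \<open>X\<close>.
\<close>

primrec arssa_iterate ::
  "'a::euclidean_space set \<Rightarrow> ('a \<Rightarrow> 'b \<Rightarrow> 'a) \<Rightarrow> (nat \<Rightarrow> real) \<Rightarrow> (nat \<Rightarrow> real) \<Rightarrow>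
    'a \<Rightarrow> (nat \<Rightarrow> 'a) \<Rightarrow> (nat \<Rightarrow> 'b) \<Rightarrow> nat \<Rightarrow> 'a" where
  "arssa_iterate X \<Phi> \<gamma> \<eta> x0 z xi 0 = x0"
| "arssa_iterate X \<Phi> \<gamma> \<eta> x0 z xi (Suc k) =
     (let x = arssa_iterate X \<Phi> \<gamma> \<eta> x0 z xi k
      in closest_point X (x - \<gamma> k *\<^sub>R (\<Phi> (x + z k) (xi k) + \<eta> k *\<^sub>R x)))"

text \<open>Index \<open>0\<close> of the averaged sequence is an empty quotient; only positive indices carry meaning.\<close>

definition arssa_average ::
  "real \<Rightarrow> 'a::euclidean_space set \<Rightarrow> ('a \<Rightarrow> 'b \<Rightarrow> 'a) \<Rightarrow> (nat \<Rightarrow> real) \<Rightarrow> (nat \<Rightarrow> real) \<Rightarrow>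
    'a \<Rightarrow> (nat \<Rightarrow> 'a) \<Rightarrow> (nat \<Rightarrow> 'b) \<Rightarrow> nat \<Rightarrow> 'a" where
  "arssa_average r X \<Phi> \<gamma> \<eta> x0 z xi k =
     (\<Sum>t<k. (\<gamma> t powr r) *\<^sub>R arssa_iterate X \<Phi> \<gamma> \<eta> x0 z xi t) /\<^sub>R (\<Sum>t<k. \<gamma> t powr r)"

end

theory Submission
  imports Defs
begin

text \<open>
  Let \<open>t\<^sub>k\<close> solve the Tikhonov regularized inequality for \<open>F x + \<eta>\<^sub>k x\<close>; then \<open>t\<^sub>k\<close> tends to the least-norm
  solution and \<open>\<parallel>t\<^sub>k - t\<^sub>k\<^sub>+\<^sub>1\<parallel>\<close> is of order \<open>(\<eta>\<^sub>k - \<eta>\<^sub>k\<^sub>+\<^sub>1) / \<eta>\<^sub>k\<close>. Monotonicity, applied to \<open>x\<^sub>k + z\<^sub>k\<close> and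
  \<open>t\<^sub>k + z\<^sub>k\<close>, and the Lipschitz bound for \<open>F\<close> near the limit give for \<open>V\<^sub>k = \<parallel>x\<^sub>k - t\<^sub>k\<parallel>\<^sup>2\<close> the pathwise recursion
  \<open>V\<^sub>k\<^sub>+\<^sub>1 \<le> (1 - 2 \<gamma>\<^sub>k \<eta>\<^sub>k) V\<^sub>k + o(\<gamma>\<^sub>k \<eta>\<^sub>k) + w\<^sub>k\<close>. The noise \<open>w\<^sub>k\<close> consists of terms of order \<open>\<gamma>\<^sub>k\<^sup>2\<close> and of
  martingale differences with variances of order \<open>\<gamma>\<^sub>k\<^sup>2\<close>, so its series converges almost surely, which
  forces \<open>V\<^sub>k\<close> to \<open>0\<close>. The averages inherit the limit since the weights have divergent sum.
  The initial point and the perturbations are independent of the samples and can be frozen by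
  Fubini's theorem, so only the samples are random in the martingale argument.
\<close>

subsection \<open>Recursions, averages and Tikhonov regularization\<close>

lemma filterlim_partial_sums_at_top:
  fixes f :: "nat \<Rightarrow> real"
  assumes "\<not> summable f" "\<And>k. 0 \<le> f k"
  shows "filterlim (\<lambda>n. \<Sum>k<n. f k) at_top sequentially"
proof -
  have mono: "mono (\<lambda>n. \<Sum>k<n. f k)"
    using assms(2) by (intro monoI sum_mono2) auto
  have "\<exists>n. Z \<le> (\<Sum>k<n. f k)" for Z
  proof (rule ccontr)
    assume "\<not> ?thesis"
    then have "summable f"
      using assms(2) by (intro summableI_nonneg_bounded[where x=Z]) (auto simp: not_le less_imp_le)
    with assms(1) show False ..
  qed
  then show ?thesis
    unfolding filterlim_at_top eventually_sequentially
    using order_trans[OF _ monoD[OF mono]] by blast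
qed

lemma not_summable_powr_ge:
  assumes "s \<ge> -1"
  shows "\<not> summable (\<lambda>n. real (n + 1) powr s)"
proof
  assume "summable (\<lambda>n. real (n + 1) powr s)"
  then have "summable (\<lambda>n. real n powr s)"
    using summable_iff_shift[of "\<lambda>n. real n powr s" 1] by simp
  with assms show False by (simp add: summable_real_powr_iff)
qed

text \<open>Toeplitz argument: the deviations before \<open>N\<close> contribute a fixed amount
  \<open>A\<close>, negligible against the divergent total weight, and the later ones are below
  \<open>e / 2\<close>.\<close>

lemma weighted_average_tendsto:
  fixes x :: "nat \<Rightarrow> 'a::real_normed_vector" and w :: "nat \<Rightarrow> real"
  assumes w: "\<And>t. 0 < w t" "filterlim (\<lambda>n. \<Sum>t<n. w t) at_top sequentially"
    and x: "x \<longlonglongrightarrow> l"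
  shows "(\<lambda>k. (\<Sum>t<k. w t *\<^sub>R x t) /\<^sub>R (\<Sum>t<k. w t)) \<longlonglongrightarrow> l"
proof (rule metric_LIMSEQ_I)
  fix e :: real assume "0 < e"
  then obtain N where N: "norm (x t - l) < e / 2" if "t \<ge> N" for t
    using x LIMSEQ_D[of x l "e / 2"] by auto
  define A where "A = (\<Sum>t<N. w t * norm (x t - l))"
  \<comment> \<open>A total weight \<open>W\<close> of at least \<open>2 * A / e + 1\<close> gives
    \<open>A < W * e / 2\<close>; the summand 1 supplies strictness and keeps \<open>W\<close>
    positive when \<open>A\<close> is 0.\<close>
  have "\<forall>\<^sub>F k in sequentially. 2 * A / e + 1 \<le> (\<Sum>t<k. w t)"
    using w(2) unfolding filterlim_at_top by blast
  then obtain K where K: "2 * A / e + 1 \<le> (\<Sum>t<k. w t)" if "k \<ge> K" for k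
    unfolding eventually_sequentially by blast
  have "dist ((\<Sum>t<k. w t *\<^sub>R x t) /\<^sub>R (\<Sum>t<k. w t)) l < e" if k: "k \<ge> max K N" for k
  proof -
    define W where "W = (\<Sum>t<k. w t)"
    have A0: "0 \<le> A" unfolding A_def using w(1) by (intro sum_nonneg) (simp add: less_imp_le)
    have W: "2 * A / e + 1 \<le> W" using K k by (simp add: W_def)
    then have W0: "0 < W" using A0 \<open>0 < e\<close> by (smt (verit) divide_nonneg_pos)
    have "(\<Sum>t<k. w t *\<^sub>R x t) /\<^sub>R W - l = (\<Sum>t<k. w t *\<^sub>R (x t - l)) /\<^sub>R W"
      using W0 by (simp add: W_def scaleR_diff_right sum_subtractf scaleR_left.sum[symmetric])
    also have "norm \<dots> \<le> (\<Sum>t<k. w t * norm (x t - l)) / W"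
      using W0 w(1) by (auto simp: divide_simps intro!: sum_norm_le)
        (simp add: abs_of_pos)
    finally have 1: "norm ((\<Sum>t<k. w t *\<^sub>R x t) /\<^sub>R W - l) \<le> (\<Sum>t<k. w t * norm (x t - l)) / W" .
    have "{..<k} = {..<N} \<union> {N..<k}" using k by auto
    then have "(\<Sum>t<k. w t * norm (x t - l)) = A + (\<Sum>t\<in>{N..<k}. w t * norm (x t - l))"
      unfolding A_def by (simp add: sum.union_disjoint ivl_disj_int_one)
    also have "(\<Sum>t\<in>{N..<k}. w t * norm (x t - l)) \<le> (\<Sum>t\<in>{N..<k}. w t * (e / 2))"
      using N w(1) by (intro sum_mono mult_left_mono) (auto simp: less_imp_le)
    also have "\<dots> \<le> (\<Sum>t<k. w t * (e / 2))"
      using w(1) \<open>0 < e\<close> by (intro sum_mono2) (auto simp: less_imp_le)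
    also have "\<dots> = W * (e / 2)" by (simp add: W_def sum_distrib_right sum_divide_distrib)
    also have "A + W * (e / 2) < e * W"
      using W \<open>0 < e\<close> by (simp add: field_simps)
    finally have "(\<Sum>t<k. w t * norm (x t - l)) / W < e" using W0 by (simp add: divide_simps)
    with 1 show ?thesis by (simp add: W_def dist_norm)
  qed
  then show "\<exists>K. \<forall>k\<ge>K. dist ((\<Sum>t<k. w t *\<^sub>R x t) /\<^sub>R (\<Sum>t<k. w t)) l < e" by blast
qed

text \<open>The noise \<open>w\<close> has no sign and its series may converge only conditionally,
  so absolute values would lose too much. Adding the tail \<open>T k\<close> of the series absorbs
  it: \<open>U = V + T\<close> obeys the same recursion without noise and with the error
  \<open>\<delta> k + T k\<close>, which still tends to 0.\<close>

lemma perturbed_contraction_tendsto_0: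
  fixes V \<alpha> \<delta> w :: "nat \<Rightarrow> real"
  assumes V: "\<And>k. 0 \<le> V k"
    and rec: "\<forall>\<^sub>F k in sequentially. V (Suc k) \<le> (1 - \<alpha> k) * V k + \<alpha> k * \<delta> k + w k"
    and \<alpha>: "\<And>k. 0 \<le> \<alpha> k" "\<alpha> \<longlonglongrightarrow> 0" "\<not> summable \<alpha>"
    and \<delta>: "\<delta> \<longlonglongrightarrow> 0"
    and w: "summable w"
  shows "V \<longlonglongrightarrow> 0"
proof (rule metric_LIMSEQ_I)
  fix e :: real assume "0 < e"
  define T where "T k = (\<Sum>j. w (j + k))" for k
  have T_lim: "T \<longlonglongrightarrow> 0"
    using suminf_exist_split2[OF w] by (simp add: T_def[abs_def])
  have T_Suc: "T k = w k + T (Suc k)" for k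
    using suminf_split_head[of "\<lambda>j. w (j + k)"] w by (simp add: T_def)
  define U where "U k = V k + T k" for k
  \<comment> \<open>In the end \<open>U k < 2 * d\<close> and \<open>- d < T k\<close> give
    \<open>V k < 3 * d\<close>, which is \<open>e\<close>.\<close>
  define d where "d = e / 3"
  have "0 < d" using \<open>0 < e\<close> by (simp add: d_def)
  have "(\<lambda>k. \<delta> k + T k) \<longlonglongrightarrow> 0" using tendsto_add[OF \<delta> T_lim] by simp
  then have "\<forall>\<^sub>F k in sequentially. \<delta> k + T k < d" using \<open>0 < d\<close> by (rule order_tendstoD(2))
  moreover have "\<forall>\<^sub>F k in sequentially. \<alpha> k < 1" using \<alpha>(2) by (rule order_tendstoD) simp
  moreover have "\<forall>\<^sub>F k in sequentially. - d < T k" using T_lim \<open>0 < d\<close> by (intro order_tendstoD) auto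
  ultimately have "\<forall>\<^sub>F k in sequentially. \<delta> k + T k < d \<and> \<alpha> k < 1 \<and> - d < T k \<and>
      V (Suc k) \<le> (1 - \<alpha> k) * V k + \<alpha> k * \<delta> k + w k"
    using rec by eventually_elim auto
  then obtain K where K: "\<delta> k + T k < d" "\<alpha> k < 1" "- d < T k"
      "V (Suc k) \<le> (1 - \<alpha> k) * V k + \<alpha> k * \<delta> k + w k" if "k \<ge> K" for k
    unfolding eventually_sequentially by blast
  have step: "U (Suc k) - d \<le> (1 - \<alpha> k) * (U k - d)" if "k \<ge> K" for k
  proof -
    have "U (Suc k) \<le> (1 - \<alpha> k) * V k + \<alpha> k * \<delta> k + T k"
      using K(4)[OF that] T_Suc[of k] by (simp add: U_def)
    also have "\<dots> = (1 - \<alpha> k) * U k + \<alpha> k * (\<delta> k + T k)" by (simp add: U_def algebra_simps)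
    also have "\<dots> \<le> (1 - \<alpha> k) * U k + \<alpha> k * d"
      using K(1)[OF that] \<alpha>(1)[of k] by (intro add_left_mono mult_left_mono) auto
    finally show ?thesis by (simp add: algebra_simps)
  qed
  \<comment> \<open>The absolute value keeps the constant nonnegative, so that
    \<open>1 - \<alpha> \<le> exp (- \<alpha>)\<close> can be multiplied into the bound whatever the
    sign of \<open>U K - d\<close>.\<close>
  define c where "c = \<bar>U K - d\<bar>"
  have decay: "U (K + n) - d \<le> c * exp (- (\<Sum>j<n. \<alpha> (K + j)))" for n
  proof (induction n)
    case 0 then show ?case by (simp add: c_def)
  next
    case (Suc n)
    have "U (K + Suc n) - d \<le> (1 - \<alpha> (K + n)) * (U (K + n) - d)" using step[of "K + n"] by simp
    also have "\<dots> \<le> (1 - \<alpha> (K + n)) * (c * exp (- (\<Sum>j<n. \<alpha> (K + j))))"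
      using Suc K(2)[of "K + n"] by (intro mult_left_mono) auto
    also have "\<dots> \<le> exp (- \<alpha> (K + n)) * (c * exp (- (\<Sum>j<n. \<alpha> (K + j))))"
      using exp_ge_add_one_self[of "- \<alpha> (K + n)"] by (intro mult_right_mono) (auto simp: c_def)
    also have "\<dots> = c * exp (- (\<Sum>j<Suc n. \<alpha> (K + j)))" by (simp add: exp_add[symmetric])
    finally show ?case .
  qed
  have "\<not> summable (\<lambda>j. \<alpha> (K + j))"
    using \<alpha>(3) summable_iff_shift[of \<alpha> K] by (simp add: add.commute)
  then have "filterlim (\<lambda>n. \<Sum>j<n. \<alpha> (K + j)) at_top sequentially"
    using \<alpha>(1) by (intro filterlim_partial_sums_at_top) auto
  then have "(\<lambda>n. exp (- (\<Sum>j<n. \<alpha> (K + j)))) \<longlonglongrightarrow> 0"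
    by (intro filterlim_compose[OF exp_at_bot]) (simp add: filterlim_uminus_at_bot)
  then have "(\<lambda>n. c * exp (- (\<Sum>j<n. \<alpha> (K + j)))) \<longlonglongrightarrow> 0" by (rule tendsto_mult_right_zero)
  then have "\<forall>\<^sub>F n in sequentially. c * exp (- (\<Sum>j<n. \<alpha> (K + j))) < d"
    using \<open>0 < d\<close> by (rule order_tendstoD)
  then obtain N where N: "c * exp (- (\<Sum>j<n. \<alpha> (K + j))) < d" if "n \<ge> N" for n
    unfolding eventually_sequentially by blast
  have "dist (V k) 0 < e" if "k \<ge> K + N" for k
  proof -
    obtain n where "k = K + n" "N \<le> n" using \<open>k \<ge> K + N\<close> nat_le_iff_add by auto
    then have "U k < 2 * d" using decay[of n] N[of n] by simp
    moreover have "V k < U k + d" using K(3)[of k] that by (simp add: U_def)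
    ultimately show ?thesis using V[of k] by (simp add: d_def)
  qed
  then show "\<exists>N. \<forall>k\<ge>N. dist (V k) 0 < e" by blast
qed

text \<open>Brouwer's theorem for \<open>x \<mapsto> closest_point X (x - G x)\<close>.\<close>

lemma VI_solutions_nonempty:
  fixes G :: "'a::euclidean_space \<Rightarrow> 'a"
  assumes X: "compact X" "convex X" "X \<noteq> {}" and G: "continuous_on X G"
  shows "VI_solutions X G \<noteq> {}"
proof -
  have cl: "closed X" using X(1) by (rule compact_imp_closed)
  have "continuous_on X (\<lambda>x. closest_point X (x - G x))"
    by (rule continuous_on_compose2[OF continuous_on_closest_point[OF X(2) cl X(3), of UNIV]
          continuous_on_diff[OF continuous_on_id G] subset_UNIV])
  moreover have "(\<lambda>x. closest_point X (x - G x)) \<in> X \<rightarrow> X"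
    using closest_point_in_set[OF cl X(3)] by auto
  ultimately obtain t where t: "t \<in> X" "closest_point X (t - G t) = t"
    by (rule brouwer[OF X])
  have "0 \<le> G t \<bullet> (x - t)" if "x \<in> X" for x
    using closest_point_dot[OF X(2) cl that, of "t - G t"] unfolding t(2) by simp
  with t(1) show ?thesis by (auto simp: VI_solutions_def)
qed

section \<open>Tikhonov regularization of monotone variational inequalities\<close>

lemma monotone_map_onD:
  "monotone_map_on S F \<Longrightarrow> x \<in> S \<Longrightarrow> y \<in> S \<Longrightarrow> 0 \<le> (F x - F y) \<bullet> (x - y)"
  by (simp add: monotone_map_on_def)

lemma VI_solutionsD:
  assumes "s \<in> VI_solutions X F"
  shows "s \<in> X" "x \<in> X \<Longrightarrow> 0 \<le> F s \<bullet> (x - s)"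
  using assms by (auto simp: VI_solutions_def)

text \<open>Each inequality is tested at the solution of the other one; after adding monotonicity
  all terms with \<open>F\<close> cancel. The inner product form passes to limits and later
  identifies the limit of the regularized solutions.\<close>

lemma tikhonov_inner_le:
  assumes mono: "monotone_map_on X F" and \<mu>: "0 < \<mu>"
    and t: "t \<in> VI_solutions X (\<lambda>x. F x + \<mu> *\<^sub>R x)" and s: "s \<in> VI_solutions X F"
  shows "t \<bullet> t \<le> t \<bullet> s"
proof -
  have "0 \<le> F s \<bullet> (t - s)" "0 \<le> (F t + \<mu> *\<^sub>R t) \<bullet> (s - t)" "0 \<le> (F t - F s) \<bullet> (t - s)"
    using VI_solutionsD[OF t] VI_solutionsD[OF s] monotone_map_onD[OF mono] by auto
  then have "0 \<le> \<mu> * (t \<bullet> s - t \<bullet> t)" by (simp add: inner_simps algebra_simps)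
  with \<mu> show ?thesis by (simp add: zero_le_mult_iff)
qed

text \<open>The same cancellation leaves \<open>\<mu>\<close> times the squared distance, bounded by
  \<open>(\<mu> - \<mu>') * (t' \<bullet> (t' - t))\<close>. This controls the drift of the
  regularized solutions when the parameter changes.\<close>

lemma tikhonov_dist_le:
  assumes mono: "monotone_map_on X F" and \<mu>: "0 < \<mu>"
    and t: "t \<in> VI_solutions X (\<lambda>x. F x + \<mu> *\<^sub>R x)"
    and t': "t' \<in> VI_solutions X (\<lambda>x. F x + \<mu>' *\<^sub>R x)"
  shows "norm (t - t') \<le> \<bar>\<mu> - \<mu>'\<bar> / \<mu> * norm t'"
proof (cases "t = t'")
  case False
  have "0 \<le> (F t + \<mu> *\<^sub>R t) \<bullet> (t' - t)" "0 \<le> (F t' + \<mu>' *\<^sub>R t') \<bullet> (t - t')"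
      "0 \<le> (F t - F t') \<bullet> (t - t')"
    using VI_solutionsD[OF t] VI_solutionsD[OF t'] monotone_map_onD[OF mono] by auto
  then have "\<mu> * ((t - t') \<bullet> (t - t')) \<le> (\<mu> - \<mu>') * (t' \<bullet> (t' - t))"
    by (simp add: inner_simps algebra_simps inner_commute)
  also have "\<dots> \<le> \<bar>\<mu> - \<mu>'\<bar> * \<bar>t' \<bullet> (t' - t)\<bar>" by (metis abs_ge_self abs_mult)
  also have "\<dots> \<le> \<bar>\<mu> - \<mu>'\<bar> * (norm t' * norm (t - t'))"
    using Cauchy_Schwarz_ineq2[of t' "t' - t"] by (intro mult_left_mono) (auto simp: norm_minus_commute)
  finally have "(\<mu> * norm (t - t')) * norm (t - t') \<le> (\<bar>\<mu> - \<mu>'\<bar> * norm t') * norm (t - t')"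
    by (simp add: power2_norm_eq_inner[symmetric] power2_eq_square algebra_simps)
  then have "\<mu> * norm (t - t') \<le> \<bar>\<mu> - \<mu>'\<bar> * norm t'" using False by simp
  with \<mu> show ?thesis by (simp add: field_simps)
qed (use \<mu> in simp)

text \<open>By compactness, a subsequence staying away from \<open>tstar\<close> would have a limit
  point \<open>l\<close>. Continuity makes \<open>l\<close> a solution, and
  \<open>tikhonov_inner_le\<close> in the limit forces it to be \<open>tstar\<close>.\<close>

lemma tikhonov_tendsto_least_norm:
  fixes X :: "'a::euclidean_space set"
  assumes X: "compact X" and mono: "monotone_map_on X F" and cont: "continuous_on X F"
    and tstar: "is_arg_min norm (\<lambda>s. s \<in> VI_solutions X F) tstar"
    and \<mu>: "\<And>k. 0 < \<mu> k" "\<mu> \<longlonglongrightarrow> 0"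
    and t: "\<And>k. t k \<in> VI_solutions X (\<lambda>x. F x + \<mu> k *\<^sub>R x)"
  shows "t \<longlonglongrightarrow> tstar"
proof (rule ccontr)
  have ts: "tstar \<in> VI_solutions X F" "\<And>s. s \<in> VI_solutions X F \<Longrightarrow> norm tstar \<le> norm s"
    using tstar by (auto simp: is_arg_min_def not_less)
  have tX: "t k \<in> X" for k using t by (rule VI_solutionsD)
  assume "\<not> t \<longlonglongrightarrow> tstar"
  then obtain e where e: "0 < e" "\<exists>\<^sub>F k in sequentially. e \<le> dist (t k) tstar"
    by (auto simp: tendsto_iff frequently_def not_le)
  then have "infinite {k. e \<le> dist (t k) tstar}"
    by (simp add: frequently_cofinite[symmetric] cofinite_eq_sequentially)
  then obtain r :: "nat \<Rightarrow> nat" where r: "strict_mono r" "\<And>k. e \<le> dist (t (r k)) tstar"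
    using infinite_enumerate by blast
  obtain l q where lq: "l \<in> X" "strict_mono q" "((\<lambda>k. t (r k)) \<circ> q) \<longlonglongrightarrow> l"
    using X tX unfolding compact_def by (meson)
  define p where "p = r \<circ> q"
  have p: "strict_mono p" using r(1) lq(2) by (auto simp: p_def intro: strict_mono_o)
  have tl: "(\<lambda>k. t (p k)) \<longlonglongrightarrow> l" using lq(3) by (simp add: o_def p_def)
  have \<mu>l: "(\<lambda>k. \<mu> (p k)) \<longlonglongrightarrow> 0" using LIMSEQ_subseq_LIMSEQ[OF \<mu>(2) p] by (simp add: o_def)
  have Fl: "(\<lambda>k. F (t (p k))) \<longlonglongrightarrow> F l"
    by (rule continuous_on_tendsto_compose[OF cont tl lq(1)]) (simp add: tX)
  have "l \<in> VI_solutions X F"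
    unfolding VI_solutions_def
  proof (intro CollectI conjI ballI lq(1))
    fix x assume "x \<in> X"
    have "(\<lambda>k. (F (t (p k)) + \<mu> (p k) *\<^sub>R t (p k)) \<bullet> (x - t (p k))) \<longlonglongrightarrow> (F l + 0 *\<^sub>R l) \<bullet> (x - l)"
      by (intro tendsto_intros Fl \<mu>l tl)
    then show "0 \<le> F l \<bullet> (x - l)"
      using VI_solutionsD(2)[OF t \<open>x \<in> X\<close>] by (auto intro: LIMSEQ_le_const)
  qed
  then have "norm tstar \<le> norm l" by (rule ts)
  have "(\<lambda>k. t (p k) \<bullet> tstar - t (p k) \<bullet> t (p k)) \<longlonglongrightarrow> l \<bullet> tstar - l \<bullet> l"
    by (intro tendsto_intros tl)
  then have "l \<bullet> l \<le> l \<bullet> tstar"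
    using tikhonov_inner_le[OF mono \<mu>(1) t ts(1)] by (auto dest: LIMSEQ_le_const[where a=0])
  moreover have "tstar \<bullet> tstar \<le> l \<bullet> l"
    using \<open>norm tstar \<le> norm l\<close> by (simp add: norm_le)
  \<comment> \<open>The left side is \<open>(l \<bullet> l - l \<bullet> tstar) + (tstar \<bullet>
    tstar - l \<bullet> tstar)\<close>, and \<open>tstar \<bullet> tstar \<le> l \<bullet> l \<le> l
    \<bullet> tstar\<close>.\<close>
  ultimately have "(l - tstar) \<bullet> (l - tstar) \<le> 0" by (simp add: inner_simps inner_commute)
  then have "l = tstar" by (metis eq_iff_diff_eq_0 inner_gt_zero_iff not_le)
  moreover have "(\<lambda>k. dist (t (p k)) tstar) \<longlonglongrightarrow> dist l tstar" by (intro tendsto_intros tl)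
  then have "e \<le> dist l tstar" using r(2) by (auto intro!: LIMSEQ_le_const simp: p_def)
  ultimately show False using e(1) by simp
qed

text \<open>Mean value inequality on a ball, which is convex. The operator norm of the Jacobian is
  at most the number of its entries times the bound \<open>B\<close> on each of them, whence the
  value of \<open>L\<close>.\<close>

lemma bounded_jacobian_imp_lipschitz:
  fixes F :: "real ^ 'n \<Rightarrow> real ^ 'm"
  assumes "\<forall>\<^sub>F x in nhds p. F differentiable (at x) \<and> norm (jacobian F (at x)) \<le> B"
  obtains \<rho> L where "0 < \<rho>" "0 \<le> L"
    "\<And>x y. x \<in> ball p \<rho> \<Longrightarrow> y \<in> ball p \<rho> \<Longrightarrow> norm (F x - F y) \<le> L * norm (x - y)"
proof -
  obtain \<rho> where \<rho>: "0 < \<rho>"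
    "\<And>x. x \<in> ball p \<rho> \<Longrightarrow> F differentiable (at x) \<and> norm (jacobian F (at x)) \<le> B"
    using assms unfolding eventually_nhds_metric by (auto simp: dist_commute)
  define L where "L = real CARD('m) * real CARD('n) * B"
  have B: "\<bar>jacobian F (at x) $ i $ j\<bar> \<le> B" if "x \<in> ball p \<rho>" for x i j
    using \<rho>(2)[OF that] component_le_norm_cart[of "jacobian F (at x) $ i" j]
      Finite_Cartesian_Product.norm_nth_le[of "jacobian F (at x)" i] by linarith
  have "0 \<le> B" using \<rho>(2)[of p] \<rho>(1) by (meson centre_in_ball norm_ge_zero order_trans)
  have "norm (F x - F y) \<le> L * norm (x - y)" if "x \<in> ball p \<rho>" "y \<in> ball p \<rho>" for x y
  proof (rule differentiable_bound[OF convex_ball _ _ that])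
    fix u assume u: "u \<in> ball p \<rho>"
    then show "(F has_derivative (\<lambda>h. jacobian F (at u) *v h)) (at u within ball p \<rho>)"
      using \<rho>(2) jacobian_works has_derivative_at_withinI by blast
    show "onorm (\<lambda>h. jacobian F (at u) *v h) \<le> L"
      unfolding L_def by (rule onorm_le_matrix_component[OF B[OF u]])
  qed
  with \<rho>(1) \<open>0 \<le> B\<close> show ?thesis by (intro that[of \<rho> L]) (auto simp: L_def)
qed

subsection \<open>Square-integrable martingale differences\<close>

lemma integrable_mult_of_squares:
  fixes f g :: "'a \<Rightarrow> real"
  assumes [measurable]: "f \<in> borel_measurable M" "g \<in> borel_measurable M"
    and "integrable M (\<lambda>x. (f x)\<^sup>2)" "integrable M (\<lambda>x. (g x)\<^sup>2)"
  shows "integrable M (\<lambda>x. f x * g x)"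
proof (rule Bochner_Integration.integrable_bound)
  show "integrable M (\<lambda>x. (f x)\<^sup>2 + (g x)\<^sup>2)" using assms(3,4) by simp
  show "AE x in M. norm (f x * g x) \<le> norm ((f x)\<^sup>2 + (g x)\<^sup>2)"
  proof (rule AE_I2)
    fix x
    have "0 \<le> (\<bar>f x\<bar> - \<bar>g x\<bar>)\<^sup>2" by simp
    then have "2 * (\<bar>f x\<bar> * \<bar>g x\<bar>) \<le> (f x)\<^sup>2 + (g x)\<^sup>2" by (simp add: power2_diff)
    moreover have "0 \<le> \<bar>f x\<bar> * \<bar>g x\<bar>" by simp
    ultimately have "\<bar>f x\<bar> * \<bar>g x\<bar> \<le> (f x)\<^sup>2 + (g x)\<^sup>2" by linarith
    then show "norm (f x * g x) \<le> norm ((f x)\<^sup>2 + (g x)\<^sup>2)"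
      by (simp add: abs_mult)
  qed
qed measurable

text \<open>Index convention: \<open>F k\<close> is the information available before step
  \<open>k\<close>. Hence \<open>m k\<close> is measurable only for \<open>F (Suc k)\<close>, while
  the partial sum over indices below \<open>n\<close> is measurable for \<open>F n\<close>.\<close>

locale square_integrable_martingale_differences = prob_space M for M :: "'a measure" +
  fixes F :: "nat \<Rightarrow> 'a measure" and m :: "nat \<Rightarrow> 'a \<Rightarrow> real"
  assumes subalg: "\<And>k. subalgebra M (F k)"
    and mono: "\<And>i j. i \<le> j \<Longrightarrow> subalgebra (F j) (F i)"
    and adapted: "\<And>k. m k \<in> borel_measurable (F (Suc k))"
    and square_integrable: "\<And>k. integrable M (\<lambda>\<omega>. (m k \<omega>)\<^sup>2)"
    and cond_exp_zero: "\<And>k. AE \<omega> in M. real_cond_exp M (F k) (m k) \<omega> = 0"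
begin

definition S :: "nat \<Rightarrow> 'a \<Rightarrow> real" where
  "S n \<omega> = (\<Sum>k<n. m k \<omega>)"

lemma S_simps [simp]: "S 0 \<omega> = 0" "S (Suc n) \<omega> = S n \<omega> + m n \<omega>"
  by (simp_all add: S_def)

lemma m_measurable [measurable]: "m k \<in> borel_measurable M"
  using adapted measurable_from_subalg[OF subalg] by blast

lemma S_adapted: "k \<le> n \<Longrightarrow> S k \<in> borel_measurable (F n)"
  unfolding S_def[abs_def] by (intro borel_measurable_sum measurable_from_subalg[OF mono adapted]) auto

lemma S_measurable [measurable]: "S n \<in> borel_measurable M"
  by (rule measurable_from_subalg[OF subalg S_adapted[OF order_refl]])

lemma integrable_indicator_square:
  assumes "A \<in> sets M" "integrable M (\<lambda>\<omega>. (f \<omega>)\<^sup>2)"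
  shows "integrable M (\<lambda>\<omega>. indicator A \<omega> * (f \<omega> :: real)\<^sup>2)"
  using integrable_mult_indicator[OF assms] by simp

lemma S_square_integrable: "integrable M (\<lambda>\<omega>. (S n \<omega>)\<^sup>2)"
proof (induction n)
  case (Suc n)
  have "integrable M (\<lambda>\<omega>. S n \<omega> * m n \<omega>)"
    by (intro integrable_mult_of_squares Suc square_integrable) measurable
  then have "integrable M (\<lambda>\<omega>. (S n \<omega>)\<^sup>2 + (m n \<omega>)\<^sup>2 + 2 * (S n \<omega> * m n \<omega>))"
    using Suc square_integrable by simp
  then show ?case by (simp add: power2_sum algebra_simps)
qed simp

text \<open>A factor known at time \<open>k\<close> can be pulled out of the conditional
  expectation, which is 0; the square integrability of both factors makes the product
  integrable.\<close>

lemma orthogonal: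
  assumes g: "g \<in> borel_measurable (F k)" "integrable M (\<lambda>\<omega>. (g \<omega>)\<^sup>2)"
  shows "(\<integral>\<omega>. g \<omega> * m k \<omega> \<partial>M) = 0"
proof -
  interpret finite_measure_subalgebra M "F k"
    using subalg by unfold_locales
  have [measurable]: "g \<in> borel_measurable M"
    using g(1) measurable_from_subalg[OF subalg] by blast
  have "integrable M (\<lambda>\<omega>. g \<omega> * m k \<omega>)"
    by (intro integrable_mult_of_squares g square_integrable) measurable
  then have "(\<integral>\<omega>. g \<omega> * m k \<omega> \<partial>M) = (\<integral>\<omega>. g \<omega> * real_cond_exp M (F k) (m k) \<omega> \<partial>M)"
    by (rule real_cond_exp_intg(2)[symmetric]) (use g in measurable)
  also have "\<dots> = (\<integral>\<omega>. 0 \<partial>M)"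
    using cond_exp_zero[of k] measurable_from_subalg[OF subalg borel_measurable_cond_exp[of M "F k" "m k"]]
    by (intro integral_cong_AE) auto
  finally show ?thesis by simp
qed

text \<open>Pythagoras on an event known at time \<open>n\<close>: the cross term vanishes because
  \<open>indicator A * S n\<close> is orthogonal to \<open>m n\<close>. The localization to
  \<open>A\<close> serves the first-passage events of the maximal inequality.\<close>

lemma integral_indicator_S_Suc_square:
  assumes A: "A \<in> sets (F n)"
  shows "(\<integral>\<omega>. indicator A \<omega> * (S (Suc n) \<omega>)\<^sup>2 \<partial>M) =
    (\<integral>\<omega>. indicator A \<omega> * (S n \<omega>)\<^sup>2 \<partial>M) + (\<integral>\<omega>. indicator A \<omega> * (m n \<omega>)\<^sup>2 \<partial>M)"
proof -
  have AM [measurable]: "A \<in> sets M" using A subalg[of n] by (auto simp: subalgebra_def)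
  let ?g = "\<lambda>\<omega>. indicator A \<omega> * S n \<omega>"
  have g: "?g \<in> borel_measurable (F n)"
    using S_adapted[of n n] A by (intro borel_measurable_times borel_measurable_indicator) auto
  have "(\<lambda>\<omega>. (?g \<omega>)\<^sup>2) = (\<lambda>\<omega>. indicator A \<omega> * (S n \<omega>)\<^sup>2)"
    by (auto simp: indicator_def)
  then have g2: "integrable M (\<lambda>\<omega>. (?g \<omega>)\<^sup>2)"
    using integrable_indicator_square[OF AM S_square_integrable] by simp
  have gm: "integrable M (\<lambda>\<omega>. ?g \<omega> * m n \<omega>)"
    by (intro integrable_mult_of_squares g2 square_integrable) measurable
  have "(\<integral>\<omega>. indicator A \<omega> * (S (Suc n) \<omega>)\<^sup>2 \<partial>M) =
      (\<integral>\<omega>. indicator A \<omega> * (S n \<omega>)\<^sup>2 + indicator A \<omega> * (m n \<omega>)\<^sup>2 + 2 * (?g \<omega> * m n \<omega>) \<partial>M)"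
    by (intro Bochner_Integration.integral_cong) (auto simp: power2_sum algebra_simps)
  also have "\<dots> = (\<integral>\<omega>. indicator A \<omega> * (S n \<omega>)\<^sup>2 \<partial>M) + (\<integral>\<omega>. indicator A \<omega> * (m n \<omega>)\<^sup>2 \<partial>M)
      + 2 * (\<integral>\<omega>. ?g \<omega> * m n \<omega> \<partial>M)"
    using gm integrable_indicator_square[OF AM S_square_integrable]
      integrable_indicator_square[OF AM square_integrable] by simp
  finally show ?thesis using orthogonal[OF g g2] by simp
qed

lemma integral_indicator_S_square_mono:
  assumes "A \<in> sets (F n)" "n \<le> N"
  shows "(\<integral>\<omega>. indicator A \<omega> * (S n \<omega>)\<^sup>2 \<partial>M) \<le> (\<integral>\<omega>. indicator A \<omega> * (S N \<omega>)\<^sup>2 \<partial>M)"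
  using assms(2)
proof (induction N rule: dec_induct)
  case (step N)
  have "A \<in> sets (F N)" using assms(1) mono[OF step(1)] by (auto simp: subalgebra_def)
  moreover have "0 \<le> (\<integral>\<omega>. indicator A \<omega> * (m N \<omega>)\<^sup>2 \<partial>M)" by simp
  ultimately show ?case using step.IH integral_indicator_S_Suc_square[of A N] by linarith
qed simp

lemma integral_S_square: "(\<integral>\<omega>. (S n \<omega>)\<^sup>2 \<partial>M) = (\<Sum>k<n. \<integral>\<omega>. (m k \<omega>)\<^sup>2 \<partial>M)"
proof (induction n)
  case (Suc n)
  have sp: "space M = space (F n)" using subalg[of n] by (simp add: subalgebra_def)
  have *: "(\<integral>\<omega>. indicator (space M) \<omega> * f \<omega> \<partial>M) = (\<integral>\<omega>. f \<omega> \<partial>M)" for f :: "'a \<Rightarrow> real"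
    by (intro Bochner_Integration.integral_cong) auto
  show ?case
    using integral_indicator_S_Suc_square[of "space M" n] Suc unfolding * by (simp add: sp)
qed simp

text \<open>Kolmogorov's inequality: split according to the first time \<open>n\<close> at which \<open>l \<le> \<bar>S n \<omega>\<bar>\<close>.\<close>

lemma maximal_inequality:
  assumes l: "0 < l"
  shows "prob {\<omega> \<in> space M. \<exists>n\<le>N. l \<le> \<bar>S n \<omega>\<bar>} \<le> (\<Sum>k<N. \<integral>\<omega>. (m k \<omega>)\<^sup>2 \<partial>M) / l\<^sup>2"
proof -
  define A where "A n = {\<omega> \<in> space M. l \<le> \<bar>S n \<omega>\<bar> \<and> (\<forall>i<n. \<bar>S i \<omega>\<bar> < l)}" for n
  \<comment> \<open>The event involves only partial sums up to \<open>n\<close>, so it is decided at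
    time \<open>n\<close>; this allows \<open>S n\<close> to be replaced by \<open>S N\<close> in
    the integral over \<open>A n\<close>.\<close>
  have AF: "A n \<in> sets (F n)" for n
  proof -
    have sp: "space M = space (F n)" using subalg[of n] by (simp add: subalgebra_def)
    have *: "A n = {\<omega> \<in> space (F n). l \<le> \<bar>S n \<omega>\<bar>} \<inter>
        {\<omega> \<in> space (F n). \<forall>i\<in>{..<n}. \<bar>S i \<omega>\<bar> < l}"
      by (auto simp: A_def sp)
    have "{\<omega> \<in> space (F n). l \<le> \<bar>S n \<omega>\<bar>} \<in> sets (F n)"
      using borel_measurable_le[OF borel_measurable_const borel_measurable_abs[OF S_adapted[OF order_refl]]]
      by simp
    moreover have "{\<omega> \<in> space (F n). \<bar>S i \<omega>\<bar> < l} \<in> sets (F n)" if "i \<in> {..<n}" for i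
      using borel_measurable_less[OF borel_measurable_abs[OF S_adapted[of i n]] borel_measurable_const] that
      by simp
    then have "{\<omega> \<in> space (F n). \<forall>i\<in>{..<n}. \<bar>S i \<omega>\<bar> < l} \<in> sets (F n)"
      by (intro sets.sets_Collect_finite_All) auto
    ultimately show ?thesis unfolding * by (rule sets.Int)
  qed
  then have AM [measurable]: "A n \<in> sets M" for n
    using subalg[of n] by (auto simp: subalgebra_def)
  have iA: "integrable M (\<lambda>\<omega>. indicator (A n) \<omega> * (S k \<omega>)\<^sup>2)" for n k
    by (rule integrable_indicator_square[OF AM S_square_integrable])
  have "l\<^sup>2 * prob (A n) \<le> (\<integral>\<omega>. indicator (A n) \<omega> * (S N \<omega>)\<^sup>2 \<partial>M)" if "n \<le> N" for n
  proof -
    have "l\<^sup>2 * prob (A n) = (\<integral>\<omega>. l\<^sup>2 * indicator (A n) \<omega> \<partial>M)" by simp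
    also have "\<dots> \<le> (\<integral>\<omega>. indicator (A n) \<omega> * (S n \<omega>)\<^sup>2 \<partial>M)"
    proof (intro integral_mono iA)
      show "l\<^sup>2 * indicator (A n) \<omega> \<le> indicator (A n) \<omega> * (S n \<omega>)\<^sup>2" for \<omega>
        using l power_mono[of l "\<bar>S n \<omega>\<bar>" 2] by (auto simp: indicator_def A_def)
    qed (simp add: less_top[symmetric])
    also have "\<dots> \<le> (\<integral>\<omega>. indicator (A n) \<omega> * (S N \<omega>)\<^sup>2 \<partial>M)"
      by (rule integral_indicator_S_square_mono[OF AF that])
    finally show ?thesis .
  qed
  then have "(\<Sum>n\<le>N. l\<^sup>2 * prob (A n)) \<le> (\<Sum>n\<le>N. \<integral>\<omega>. indicator (A n) \<omega> * (S N \<omega>)\<^sup>2 \<partial>M)"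
    by (intro sum_mono) auto
  also have "\<dots> = (\<integral>\<omega>. (\<Sum>n\<le>N. indicator (A n) \<omega>) * (S N \<omega>)\<^sup>2 \<partial>M)"
    unfolding sum_distrib_right by (rule Bochner_Integration.integral_sum[OF iA, symmetric])
  also have "\<dots> \<le> (\<integral>\<omega>. (S N \<omega>)\<^sup>2 \<partial>M)"
  proof (intro integral_mono S_square_integrable)
    show "integrable M (\<lambda>\<omega>. (\<Sum>n\<le>N. indicator (A n) \<omega>) * (S N \<omega>)\<^sup>2)"
      unfolding sum_distrib_right by (rule Bochner_Integration.integrable_sum[OF iA])
    fix \<omega>
    have "A i \<inter> A j = {}" if "i < j" for i j
      using that by (auto simp: A_def)
    then have "disjoint_family_on A {..N}"
      unfolding disjoint_family_on_def by (metis Int_commute linorder_neqE_nat)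
    then have "(\<Sum>n\<le>N. indicator (A n) \<omega>) = (indicator (\<Union>n\<le>N. A n) \<omega> :: real)"
      by (rule indicator_UN_disjoint[symmetric, OF finite_atMost])
    then show "(\<Sum>n\<le>N. indicator (A n) \<omega>) * (S N \<omega>)\<^sup>2 \<le> (S N \<omega>)\<^sup>2"
      by (simp add: indicator_def)
  qed
  finally have "(\<Sum>n\<le>N. prob (A n)) \<le> (\<Sum>k<N. \<integral>\<omega>. (m k \<omega>)\<^sup>2 \<partial>M) / l\<^sup>2"
    using l by (simp only: integral_S_square sum_distrib_left[symmetric]) (simp add: pos_le_divide_eq mult.commute)
  moreover have "prob {\<omega> \<in> space M. \<exists>n\<le>N. l \<le> \<bar>S n \<omega>\<bar>} \<le> prob (\<Union>n\<le>N. A n)"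
  proof (rule finite_measure_mono)
    show "{\<omega> \<in> space M. \<exists>n\<le>N. l \<le> \<bar>S n \<omega>\<bar>} \<subseteq> (\<Union>n\<le>N. A n)"
    proof clarsimp
      fix \<omega> n assume "\<omega> \<in> space M" "n \<le> N" "l \<le> \<bar>S n \<omega>\<bar>"
      define n' where "n' = (LEAST n. l \<le> \<bar>S n \<omega>\<bar>)"
      have "l \<le> \<bar>S n' \<omega>\<bar>" "n' \<le> n" "\<forall>i<n'. \<bar>S i \<omega>\<bar> < l"
        unfolding n'_def using LeastI[of "\<lambda>n. l \<le> \<bar>S n \<omega>\<bar>", OF \<open>l \<le> \<bar>S n \<omega>\<bar>\<close>]
          Least_le[of "\<lambda>n. l \<le> \<bar>S n \<omega>\<bar>", OF \<open>l \<le> \<bar>S n \<omega>\<bar>\<close>]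
          not_less_Least[of _ "\<lambda>n. l \<le> \<bar>S n \<omega>\<bar>"]
        by (simp_all add: not_le)
      with \<open>\<omega> \<in> space M\<close> \<open>n \<le> N\<close> show "\<exists>n\<in>{..N}. \<omega> \<in> A n"
        by (intro bexI[of _ n']) (auto simp: A_def)
    qed
  qed measurable
  moreover have "prob (\<Union>n\<le>N. A n) \<le> (\<Sum>n\<le>N. prob (A n))"
    by (intro finite_measure_subadditive_finite) auto
  ultimately show ?thesis by linarith
qed

lemma shift: "square_integrable_martingale_differences M (\<lambda>k. F (s + k)) (\<lambda>k. m (s + k))"
  using subalg mono adapted square_integrable cond_exp_zero by unfold_locales auto

end

text \<open>The maximal inequality is applied to the martingale restarted at \<open>s\<close>. Its
  bound is uniform in the horizon \<open>N\<close>, and the events increase with \<open>N\<close>,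
  so continuity of measure removes the horizon.\<close>

lemma (in square_integrable_martingale_differences) tail_inequality:
  assumes l: "0 < l" and summable: "summable (\<lambda>k. \<integral>\<omega>. (m k \<omega>)\<^sup>2 \<partial>M)"
  shows "prob {\<omega> \<in> space M. \<exists>n. l \<le> \<bar>\<Sum>k<n. m (s + k) \<omega>\<bar>} \<le> (\<Sum>k. \<integral>\<omega>. (m (k + s) \<omega>)\<^sup>2 \<partial>M) / l\<^sup>2"
proof -
  interpret sh: square_integrable_martingale_differences M "\<lambda>k. F (s + k)" "\<lambda>k. m (s + k)"
    by (rule shift)
  let ?B = "\<lambda>N. {\<omega> \<in> space M. \<exists>n\<le>N. l \<le> \<bar>\<Sum>k<n. m (s + k) \<omega>\<bar>}"
  have un: "(\<Union>N. ?B N) = {\<omega> \<in> space M. \<exists>n. l \<le> \<bar>\<Sum>k<n. m (s + k) \<omega>\<bar>}" by auto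
  have B: "?B N \<in> sets M" for N by measurable
  have "(\<lambda>N. prob (?B N)) \<longlonglongrightarrow> prob (\<Union>N. ?B N)"
    using B by (intro finite_Lim_measure_incseq) (auto simp: incseq_def intro: order_trans)
  moreover have "prob (?B N) \<le> (\<Sum>k. \<integral>\<omega>. (m (k + s) \<omega>)\<^sup>2 \<partial>M) / l\<^sup>2" for N
  proof -
    have "prob (?B N) \<le> (\<Sum>k<N. \<integral>\<omega>. (m (s + k) \<omega>)\<^sup>2 \<partial>M) / l\<^sup>2"
      using sh.maximal_inequality[OF l, of N] by (simp add: sh.S_def)
    also have "(\<Sum>k<N. \<integral>\<omega>. (m (s + k) \<omega>)\<^sup>2 \<partial>M) \<le> (\<Sum>k. \<integral>\<omega>. (m (k + s) \<omega>)\<^sup>2 \<partial>M)"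
      using summable_iff_shift[THEN iffD2, OF summable, of s]
      by (simp only: add.commute[of s]) (intro sum_le_suminf, auto)
    finally show ?thesis by (simp add: divide_right_mono)
  qed
  ultimately show ?thesis unfolding un[symmetric] by (intro LIMSEQ_le_const2) auto
qed

text \<open>Cauchy criterion: the probability that the sums restarted at \<open>s\<close> ever reach
  \<open>l\<close> vanishes as \<open>s\<close> grows, since the variances are summable. Countably
  many thresholds \<open>l\<close> suffice.\<close>

theorem (in square_integrable_martingale_differences) AE_summable:
  assumes summable: "summable (\<lambda>k. \<integral>\<omega>. (m k \<omega>)\<^sup>2 \<partial>M)"
  shows "AE \<omega> in M. summable (\<lambda>k. m k \<omega>)"
proof -
  have "AE \<omega> in M. \<exists>s. \<forall>n. \<bar>\<Sum>k<n. m (s + k) \<omega>\<bar> < l" if l: "0 < l" for l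
  proof -
    define Q where "Q s = {\<omega> \<in> space M. \<exists>n. l \<le> \<bar>\<Sum>k<n. m (s + k) \<omega>\<bar>}" for s
    have Q [measurable]: "Q s \<in> sets M" for s unfolding Q_def by measurable
    have "(\<lambda>s. (\<Sum>k. \<integral>\<omega>. (m (k + s) \<omega>)\<^sup>2 \<partial>M) / l\<^sup>2) \<longlonglongrightarrow> 0 / l\<^sup>2"
      using l by (intro tendsto_divide suminf_exist_split2[OF summable]) auto
    moreover have "prob (\<Inter>s. Q s) \<le> (\<Sum>k. \<integral>\<omega>. (m (k + s) \<omega>)\<^sup>2 \<partial>M) / l\<^sup>2" for s
      using finite_measure_mono[of "\<Inter>s. Q s" "Q s"] tail_inequality[OF l summable, of s]
      by (fastforce simp: Q_def[symmetric])
    ultimately have "prob (\<Inter>s. Q s) \<le> 0" by (auto intro: LIMSEQ_le_const)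
    then have "(\<Inter>s. Q s) \<in> null_sets M"
      by (intro null_setsI) (auto simp: emeasure_eq_measure measure_le_0_iff)
    then show ?thesis by (rule AE_I') (auto simp: Q_def not_less)
  qed
  then have "AE \<omega> in M. \<forall>i. \<exists>s. \<forall>n. \<bar>\<Sum>k<n. m (s + k) \<omega>\<bar> < 1 / real (Suc i)"
    by (simp add: AE_all_countable)
  then show ?thesis
  proof eventually_elim
    case (elim \<omega>)
    show ?case unfolding summable_Cauchy
    proof (intro allI impI)
      fix e :: real assume "0 < e"
      then obtain i where i: "1 / real (Suc i) < e / 2" using nat_approx_posE[of "e / 2"] by auto
      obtain s where s: "\<bar>\<Sum>k<n. m (s + k) \<omega>\<bar> < 1 / real (Suc i)" for n using elim by blast
      \<comment> \<open>Both ends of a block are compared with the common start \<open>s\<close>;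
        each comparison costs less than \<open>e / 2\<close>.\<close>
      have shift: "(\<Sum>k<n. m k \<omega>) = (\<Sum>k<s. m k \<omega>) + (\<Sum>k<n - s. m (s + k) \<omega>)" if "s \<le> n" for n
        using sum.atLeastLessThan_concat[of 0 s n "\<lambda>k. m k \<omega>"] that
          sum.shift_bounds_nat_ivl[of "\<lambda>k. m k \<omega>" 0 s "n - s"]
        by (simp add: atLeast0LessThan add.commute)
      have "norm (sum (\<lambda>k. m k \<omega>) {p..<q}) < e" if "s \<le> p" for p q
      proof (cases "p \<le> q")
        case True
        have "sum (\<lambda>k. m k \<omega>) {p..<q} = (\<Sum>k<q. m k \<omega>) - (\<Sum>k<p. m k \<omega>)"
          using sum_diff_nat_ivl[of 0 p q "\<lambda>k. m k \<omega>"] True by (simp add: atLeast0LessThan)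
        then show ?thesis
          using shift[of p] shift[of q] s[of "p - s"] s[of "q - s"] that True i
          unfolding real_norm_def by linarith
      qed (use \<open>0 < e\<close> in simp)
      then show "\<exists>N. \<forall>p\<ge>N. \<forall>q. norm (sum (\<lambda>k. m k \<omega>) {p..<q}) < e" by blast
    qed
  qed
qed

section \<open>Freezing one of two independent variables\<close>

text \<open>Independence turns the joint law into a product, so Tonelli's theorem permits
  integration over \<open>Z\<close> with \<open>Y\<close> held fixed. It will be used with the past
  samples as \<open>Y\<close> and the current one as \<open>Z\<close>.\<close>

lemma (in prob_space) indep_var_nn_integral_le:
  assumes ind: "indep_var S Y T Z" and f: "f \<in> borel_measurable (S \<Otimes>\<^sub>M T)"
    and c: "\<And>y. y \<in> space S \<Longrightarrow> (\<integral>\<^sup>+\<omega>. f (y, Z \<omega>) \<partial>M) \<le> c"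
  shows "(\<integral>\<^sup>+\<omega>. f (Y \<omega>, Z \<omega>) \<partial>M) \<le> c"
proof -
  note [measurable] = indep_var_rv1[OF ind] indep_var_rv2[OF ind] f
  interpret Y: prob_space "distr M S Y" by (rule prob_space_distr) measurable
  interpret Z: prob_space "distr M T Z" by (rule prob_space_distr) measurable
  have "(\<integral>\<^sup>+\<omega>. f (Y \<omega>, Z \<omega>) \<partial>M) = (\<integral>\<^sup>+p. f p \<partial>distr M (S \<Otimes>\<^sub>M T) (\<lambda>\<omega>. (Y \<omega>, Z \<omega>)))"
    by (subst nn_integral_distr) measurable
  also have "\<dots> = (\<integral>\<^sup>+y. \<integral>\<^sup>+z. f (y, z) \<partial>distr M T Z \<partial>distr M S Y)"
    using ind[unfolded indep_var_distribution_eq] by (simp add: Z.nn_integral_fst)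
  also have "\<dots> \<le> (\<integral>\<^sup>+y. c \<partial>distr M S Y)"
    using c by (intro nn_integral_mono) (simp add: nn_integral_distr)
  also have "\<dots> = c" using Y.emeasure_space_1 by simp
  finally show ?thesis .
qed

text \<open>Fubini counterpart for signed integrands; it turns zero mean at every frozen past into
  zero mean at the random past.\<close>

lemma (in prob_space) indep_var_integral_eq_0:
  fixes f :: "_ \<Rightarrow> real"
  assumes ind: "indep_var S Y T Z" and f: "f \<in> borel_measurable (S \<Otimes>\<^sub>M T)"
    and int: "integrable M (\<lambda>\<omega>. f (Y \<omega>, Z \<omega>))"
    and 0: "\<And>y. y \<in> space S \<Longrightarrow> (\<integral>\<omega>. f (y, Z \<omega>) \<partial>M) = 0"
  shows "(\<integral>\<omega>. f (Y \<omega>, Z \<omega>) \<partial>M) = 0"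
proof -
  note [measurable] = indep_var_rv1[OF ind] indep_var_rv2[OF ind] f
  interpret Y: prob_space "distr M S Y" by (rule prob_space_distr) measurable
  interpret Z: prob_space "distr M T Z" by (rule prob_space_distr) measurable
  interpret YZ: pair_prob_space "distr M S Y" "distr M T Z" ..
  have eq: "distr M (S \<Otimes>\<^sub>M T) (\<lambda>\<omega>. (Y \<omega>, Z \<omega>)) = distr M S Y \<Otimes>\<^sub>M distr M T Z"
    using indep_var_distribution_eq[THEN iffD1, OF ind] by simp
  have "integrable (distr M (S \<Otimes>\<^sub>M T) (\<lambda>\<omega>. (Y \<omega>, Z \<omega>))) f"
    using int by (subst integrable_distr_eq) auto
  then have int': "integrable (distr M S Y \<Otimes>\<^sub>M distr M T Z) f" by (simp add: eq)
  have "(\<integral>\<omega>. f (Y \<omega>, Z \<omega>) \<partial>M) = (\<integral>p. f p \<partial>distr M (S \<Otimes>\<^sub>M T) (\<lambda>\<omega>. (Y \<omega>, Z \<omega>)))"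
    by (subst integral_distr) auto
  also have "\<dots> = (\<integral>y. \<integral>z. f (y, z) \<partial>distr M T Z \<partial>distr M S Y)"
    unfolding eq by (rule YZ.integral_fst'[OF int', symmetric])
  also have "\<dots> = (\<integral>y. 0 \<partial>distr M S Y)"
    using 0 by (intro Bochner_Integration.integral_cong) (simp_all add: integral_distr)
  finally show ?thesis by simp
qed

subsection \<open>Pathwise convergence\<close>

text \<open>The projection is nonexpansive and fixes \<open>t\<close>; the rest is expansion of a
  square.\<close>

lemma closest_point_step:
  fixes X :: "'a::euclidean_space set"
  assumes "convex X" "closed X" "t \<in> X"
  shows "(norm (closest_point X (x - g *\<^sub>R q) - t))\<^sup>2
    \<le> (norm (x - t))\<^sup>2 - 2 * g * (q \<bullet> (x - t)) + g\<^sup>2 * (norm q)\<^sup>2"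
proof -
  have "norm (closest_point X (x - g *\<^sub>R q) - t) \<le> norm (x - g *\<^sub>R q - t)"
    using closest_point_lipschitz[OF assms(1,2), of "x - g *\<^sub>R q" t] closest_point_self[OF assms(3)] assms(3)
    by (auto simp: dist_norm)
  then have "(norm (closest_point X (x - g *\<^sub>R q) - t))\<^sup>2 \<le> (norm ((x - t) - g *\<^sub>R q))\<^sup>2"
    by (intro power_mono) (auto simp: algebra_simps)
  also have "\<dots> = (norm (x - t))\<^sup>2 - 2 * g * (q \<bullet> (x - t)) + g\<^sup>2 * (norm q)\<^sup>2"
    unfolding power2_norm_eq_inner by (simp add: inner_simps inner_commute power2_eq_square algebra_simps)
  finally show ?thesis .
qed

text \<open>The shift \<open>z\<close> is common to \<open>x\<close> and \<open>t\<close>, so monotonicity applies to the shifted pair, and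
  only \<open>F (t + z) - F t\<close> has to be small.\<close>

lemma regularized_step:
  fixes X :: "'a::euclidean_space set"
  assumes X: "convex X" "closed X" and mono: "monotone_map_on Y F" and g: "0 \<le> g"
    and t: "t \<in> VI_solutions X (\<lambda>x. F x + \<mu> *\<^sub>R x)"
    and x: "x \<in> X" "x + z \<in> Y" "t + z \<in> Y"
    and lip: "norm (F (t + z) - F t) \<le> L * norm z" and D: "norm (x - t) \<le> D" and R: "norm x \<le> R"
  shows "(norm (closest_point X (x - g *\<^sub>R (q + \<mu> *\<^sub>R x)) - t))\<^sup>2 \<le>
    (1 - 2 * g * \<mu>) * (norm (x - t))\<^sup>2 + 2 * g * (L * norm z * D)
     + (2 * g\<^sup>2 * (norm q)\<^sup>2 + 2 * g\<^sup>2 * (\<mu>\<^sup>2 * R\<^sup>2) - 2 * (g * ((q - F (x + z)) \<bullet> (x - t))))"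
proof -
  have "- ((F (t + z) - F t) \<bullet> (x - t)) \<le> \<bar>(F (t + z) - F t) \<bullet> (x - t)\<bar>" by simp
  also have "\<dots> \<le> norm (F (t + z) - F t) * norm (x - t)" by (rule Cauchy_Schwarz_ineq2)
  also have "\<dots> \<le> L * norm z * D"
    using lip D by (intro mult_mono) (auto intro: order_trans[OF norm_ge_zero])
  finally have 1: "- (L * norm z * D) \<le> (F (t + z) - F t) \<bullet> (x - t)" by simp
  have 2: "0 \<le> (F (x + z) - F (t + z)) \<bullet> (x - t)"
    using monotone_map_onD[OF mono x(2,3)] by simp
  have 3: "0 \<le> (F t + \<mu> *\<^sub>R t) \<bullet> (x - t)" by (rule VI_solutionsD(2)[OF t x(1)])
  \<comment> \<open>The summands are, in order: sampling noise, monotonicity at the shifted pair,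
    the error of the shift at \<open>t\<close>, the regularized inequality tested at
    \<open>x\<close>, and the contraction produced by the regularization.\<close>
  have "(q + \<mu> *\<^sub>R x) \<bullet> (x - t) = (q - F (x + z)) \<bullet> (x - t) + (F (x + z) - F (t + z)) \<bullet> (x - t)
      + (F (t + z) - F t) \<bullet> (x - t) + (F t + \<mu> *\<^sub>R t) \<bullet> (x - t) + \<mu> * (norm (x - t))\<^sup>2"
    by (simp add: power2_norm_eq_inner inner_simps algebra_simps)
  with 1 2 3 have "(q - F (x + z)) \<bullet> (x - t) - L * norm z * D + \<mu> * (norm (x - t))\<^sup>2
      \<le> (q + \<mu> *\<^sub>R x) \<bullet> (x - t)" by linarith
  from mult_left_mono[OF this g]
  have 4: "g * ((q - F (x + z)) \<bullet> (x - t)) - g * (L * norm z * D) + g * \<mu> * (norm (x - t))\<^sup>2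
      \<le> g * ((q + \<mu> *\<^sub>R x) \<bullet> (x - t))" by (simp add: algebra_simps)
  have "norm (q + \<mu> *\<^sub>R x) \<le> norm q + \<bar>\<mu>\<bar> * R"
    using norm_triangle_ineq[of q "\<mu> *\<^sub>R x"] mult_left_mono[OF R, of "\<bar>\<mu>\<bar>"] by simp
  then have "(norm (q + \<mu> *\<^sub>R x))\<^sup>2 \<le> (norm q + \<bar>\<mu>\<bar> * R)\<^sup>2" by (intro power_mono) auto
  also have "\<dots> \<le> 2 * (norm q)\<^sup>2 + 2 * (\<mu>\<^sup>2 * R\<^sup>2)"
    using sum_squares_bound[of "norm q" "\<bar>\<mu>\<bar> * R"]
    unfolding power2_sum power_mult_distrib power2_abs by linarith
  finally have "g\<^sup>2 * (norm (q + \<mu> *\<^sub>R x))\<^sup>2 \<le> g\<^sup>2 * (2 * (norm q)\<^sup>2 + 2 * (\<mu>\<^sup>2 * R\<^sup>2))"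
    by (intro mult_left_mono) auto
  with closest_point_step[OF X VI_solutionsD(1)[OF t], of x g "q + \<mu> *\<^sub>R x"] 4
  show ?thesis by (simp add: algebra_simps)
qed

section \<open>Dependence of the iterates on their data and measurability\<close>

lemma arssa_iterate_in:
  assumes "closed X" "x0 \<in> X"
  shows "arssa_iterate X \<Phi> \<gamma> \<eta> x0 z xi k \<in> X"
  using assms by (induction k) (auto simp: Let_def intro!: closest_point_in_set)

text \<open>Iterate \<open>k\<close> sees only samples with index below \<open>k\<close>, and
  evaluates \<open>\<Phi>\<close> only at shifted points of \<open>X\<close>. Hence the sample
  sequence may be truncated and \<open>\<Phi>\<close> changed elsewhere.\<close>

lemma arssa_iterate_cong:
  assumes "\<And>i x. i < k \<Longrightarrow> x \<in> X \<Longrightarrow> \<Phi> (x + z i) (xi i) = \<Phi>' (x + z i) (xi' i)"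
    and "closed X" "x0 \<in> X"
  shows "arssa_iterate X \<Phi> \<gamma> \<eta> x0 z xi k = arssa_iterate X \<Phi>' \<gamma> \<eta> x0 z xi' k"
  using assms(1)
proof (induction k)
  case (Suc k)
  then have "arssa_iterate X \<Phi> \<gamma> \<eta> x0 z xi k = arssa_iterate X \<Phi>' \<gamma> \<eta> x0 z xi' k" by simp
  moreover have "arssa_iterate X \<Phi>' \<gamma> \<eta> x0 z xi' k \<in> X" by (rule arssa_iterate_in) fact+
  ultimately show ?case using Suc.prems[of k] by (simp add: Let_def)
qed simp

text \<open>Only inputs with index below \<open>k\<close> have to be measurable, so that
  \<open>A\<close> can be the \<sigma>-algebra of the first samples as well as a product of sequence
  spaces.\<close>

lemma borel_measurable_arssa_iterate:
  fixes X :: "'a::euclidean_space set" and \<Phi> :: "'a \<Rightarrow> 'b::topological_space \<Rightarrow> 'a"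
  assumes X: "closed X" "convex X" "X \<noteq> {}"
    and \<Phi>: "(\<lambda>(x, y). \<Phi> x y) \<in> borel_measurable (borel \<Otimes>\<^sub>M borel)"
    and "x0 \<in> borel_measurable A" "\<And>i. i < k \<Longrightarrow> z i \<in> borel_measurable A"
      "\<And>i. i < k \<Longrightarrow> xi i \<in> borel_measurable A"
  shows "(\<lambda>\<omega>. arssa_iterate X \<Phi> \<gamma> \<eta> (x0 \<omega>) (\<lambda>i. z i \<omega>) (\<lambda>i. xi i \<omega>) k) \<in> borel_measurable A"
  using assms(5-)
proof (induction k)
  case (Suc k)
  note [measurable] = \<Phi> Suc.prems(2,3)[OF lessI]
  have [measurable]: "closest_point X \<in> borel_measurable borel"
    by (intro borel_measurable_continuous_onI continuous_on_closest_point X)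
  have [measurable]: "(\<lambda>\<omega>. arssa_iterate X \<Phi> \<gamma> \<eta> (x0 \<omega>) (\<lambda>i. z i \<omega>) (\<lambda>i. xi i \<omega>) k) \<in> borel_measurable A"
    using Suc by simp
  show ?case by (simp add: Let_def) measurable
qed simp

section \<open>Deterministic convergence of the scheme\<close>

text \<open>The step sizes enter only through limits and series. Relative to the contraction rate
  \<open>\<gamma> k * \<eta> k\<close>, \<open>eps_lim\<close> makes the smoothing error negligible
  and \<open>\<eta>_slow\<close> the drift of the regularized solutions;
  \<open>\<gamma>_summable\<close> controls the noise, and
  \<open>\<gamma>\<eta>_not_summable\<close> makes the contraction effective.\<close>

locale regularized_scheme =
  fixes X :: "'a::euclidean_space set" and \<epsilon> :: real and F :: "'a \<Rightarrow> 'a" and tstar :: 'a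
    and \<gamma> \<eta> eps :: "nat \<Rightarrow> real" and \<rho> L :: real
  assumes X: "compact X" "convex X"
    and \<epsilon>: "0 < \<epsilon>" "\<And>k. eps k \<le> \<epsilon>"
    and mono: "monotone_map_on (X + cball 0 \<epsilon>) F"
    and cont: "continuous_on (X + cball 0 \<epsilon>) F"
    and tstar: "is_arg_min norm (\<lambda>s. s \<in> VI_solutions X F) tstar"
    and lipschitz: "0 < \<rho>" "0 \<le> L"
      "\<And>x y. x \<in> ball tstar \<rho> \<Longrightarrow> y \<in> ball tstar \<rho> \<Longrightarrow> norm (F x - F y) \<le> L * norm (x - y)"
    and \<gamma>_pos: "\<And>k. 0 < \<gamma> k" and \<eta>_pos: "\<And>k. 0 < \<eta> k"
    and \<eta>_lim: "\<eta> \<longlonglongrightarrow> 0"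
    and \<gamma>_summable: "summable (\<lambda>k. (\<gamma> k)\<^sup>2)"
    and \<gamma>\<eta>_not_summable: "\<not> summable (\<lambda>k. \<gamma> k * \<eta> k)"
    and eps_lim: "(\<lambda>k. eps k / \<eta> k) \<longlonglongrightarrow> 0"
    and \<eta>_slow: "(\<lambda>k. \<bar>\<eta> k - \<eta> (Suc k)\<bar> / (\<gamma> k * (\<eta> k)\<^sup>2)) \<longlonglongrightarrow> 0"
begin

lemma closed_X: "closed X"
  using X(1) by (rule compact_imp_closed)

lemma tstar_in: "tstar \<in> X"
  using tstar by (auto simp: is_arg_min_def VI_solutions_def)

lemma shift_in: "x \<in> X \<Longrightarrow> norm z \<le> \<epsilon> \<Longrightarrow> x + z \<in> X + cball 0 \<epsilon>"
  by (auto intro: set_plus_intro)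

lemma X_subset: "X \<subseteq> X + cball 0 \<epsilon>"
  using shift_in[of _ 0] \<epsilon>(1) by auto

lemma compact_shifted: "compact (X + cball 0 \<epsilon>)"
proof -
  have "X + cball 0 \<epsilon> = {x + y |x y. x \<in> X \<and> y \<in> cball 0 \<epsilon>}"
    unfolding set_plus_def by blast
  then show ?thesis using compact_sums[OF X(1) compact_cball[of 0 \<epsilon>]] by simp
qed

lemma mono_X: "monotone_map_on X F" and cont_X: "continuous_on X F"
  using mono cont X_subset by (auto simp: monotone_map_on_def subset_eq intro: continuous_on_subset)

definition tikhonov :: "nat \<Rightarrow> 'a" where
  "tikhonov k = (SOME t. t \<in> VI_solutions X (\<lambda>x. F x + \<eta> k *\<^sub>R x))"

lemma tikhonov: "tikhonov k \<in> VI_solutions X (\<lambda>x. F x + \<eta> k *\<^sub>R x)"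
proof -
  have "continuous_on X (\<lambda>x. F x + \<eta> k *\<^sub>R x)" by (intro continuous_intros cont_X)
  then have "VI_solutions X (\<lambda>x. F x + \<eta> k *\<^sub>R x) \<noteq> {}"
    using VI_solutions_nonempty X tstar_in by blast
  then show ?thesis unfolding tikhonov_def by (simp add: some_in_eq)
qed

lemma tikhonov_in: "tikhonov k \<in> X"
  using tikhonov by (rule VI_solutionsD)

lemma tikhonov_tendsto: "tikhonov \<longlonglongrightarrow> tstar"
  by (rule tikhonov_tendsto_least_norm[OF X(1) mono_X cont_X tstar \<eta>_pos \<eta>_lim tikhonov])

definition R :: real where
  "R = (SOME R. \<forall>x\<in>X. norm x \<le> R)"

lemma R:
  assumes "x \<in> X"
  shows "norm x \<le> R"
proof -
  have "\<exists>R. \<forall>x\<in>X. norm x \<le> R" using compact_imp_bounded[OF X(1)] by (simp add: bounded_iff)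
  from someI_ex[OF this] assms show ?thesis unfolding R_def by blast
qed

lemma R_nonneg: "0 \<le> R"
  using R[OF tstar_in] norm_ge_zero order_trans by blast

lemma diam: "x \<in> X \<Longrightarrow> y \<in> X \<Longrightarrow> norm (x - y) \<le> 2 * R"
  using R[of x] R[of y] norm_triangle_ineq4[of x y] by linarith

lemma eps_tendsto_0: "eps \<longlonglongrightarrow> 0"
proof -
  have "(\<lambda>k. eps k / \<eta> k * \<eta> k) \<longlonglongrightarrow> 0 * 0" by (intro tendsto_mult eps_lim \<eta>_lim)
  moreover have "eps k / \<eta> k * \<eta> k = eps k" for k using \<eta>_pos[of k] by simp
  ultimately show ?thesis by simp
qed

lemma \<gamma>_tendsto_0: "\<gamma> \<longlonglongrightarrow> 0"
  using summable_LIMSEQ_zero[OF \<gamma>_summable] by (simp add: tendsto_null_power)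

text \<open>No probability is involved: once the two noise series converge along a realisation,
  \<open>perturbed_contraction_tendsto_0\<close> applies to the squared distance from the
  regularized solutions, which themselves tend to \<open>tstar\<close>.\<close>

lemma iterate_tendsto:
  fixes \<Phi> :: "'a \<Rightarrow> 'b \<Rightarrow> 'a"
  assumes x0: "x0 \<in> X" and z: "\<And>k. norm (z k) \<le> eps k"
    and x_def: "\<And>k. x k = arssa_iterate X \<Phi> \<gamma> \<eta> x0 z xi k"
    and q_def: "\<And>k. q k = \<Phi> (x k + z k) (xi k)"
    and noise: "summable (\<lambda>k. (\<gamma> k)\<^sup>2 * (norm (q k))\<^sup>2)"
      "summable (\<lambda>k. \<gamma> k * ((q k - F (x k + z k)) \<bullet> (x k - tikhonov k)))"
  shows "x \<longlonglongrightarrow> tstar"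
proof -
  define V where "V k = (norm (x k - tikhonov k))\<^sup>2" for k
  define m where "m k = \<gamma> k * ((q k - F (x k + z k)) \<bullet> (x k - tikhonov k))" for k
  define w where "w k = 2 * (\<gamma> k)\<^sup>2 * (norm (q k))\<^sup>2 + 2 * (\<gamma> k)\<^sup>2 * ((\<eta> k)\<^sup>2 * R\<^sup>2) - 2 * m k" for k
  \<comment> \<open>Smoothing error and drift, both divided by the rate
    \<open>2 * \<gamma> k * \<eta> k\<close>.\<close>
  define \<delta> where "\<delta> k = L * (2 * R) * (eps k / \<eta> k) +
      2 * R\<^sup>2 * (\<bar>\<eta> k - \<eta> (Suc k)\<bar> / (\<gamma> k * (\<eta> k)\<^sup>2))" for k
  have xX: "x k \<in> X" for k unfolding x_def by (rule arssa_iterate_in[OF closed_X x0])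
  have x_Suc: "x (Suc k) = closest_point X (x k - \<gamma> k *\<^sub>R (q k + \<eta> k *\<^sub>R x k))" for k
    by (simp add: x_def q_def Let_def)
  have rec: "V (Suc k) \<le> (1 - 2 * \<gamma> k * \<eta> k) * V k + (2 * \<gamma> k * \<eta> k) * \<delta> k + w k"
    if ball: "tikhonov k \<in> ball tstar \<rho>" "tikhonov k + z k \<in> ball tstar \<rho>" for k
  proof -
    let ?t = "tikhonov k" and ?t' = "tikhonov (Suc k)"
    have pos: "0 < \<gamma> k" "0 < \<eta> k" by (rule \<gamma>_pos \<eta>_pos)+
    have zk: "norm (z k) \<le> \<epsilon>" using z[of k] \<epsilon>(2)[of k] by simp
    have 1: "(norm (x (Suc k) - ?t))\<^sup>2 \<le>
        (1 - 2 * \<gamma> k * \<eta> k) * V k + 2 * \<gamma> k * (L * norm (z k) * (2 * R)) + w k"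
      unfolding x_Suc V_def w_def m_def using lipschitz(3)[OF ball(2,1)] xX tikhonov_in zk pos
      by (intro regularized_step[OF X(2) closed_X mono _ tikhonov] diam R shift_in) auto
    \<comment> \<open>\<open>V (Suc k)\<close> measures the distance from the next regularized
      solution \<open>?t'\<close>, the projected step that from \<open>?t\<close>. The difference of
      squares is factored so that the drift of the regularized solutions bounds one factor and the
      diameter the other.\<close>
    have "V (Suc k) - (norm (x (Suc k) - ?t))\<^sup>2 =
        (norm (x (Suc k) - ?t') - norm (x (Suc k) - ?t)) * (norm (x (Suc k) - ?t') + norm (x (Suc k) - ?t))"
      by (simp add: V_def power2_eq_square algebra_simps)
    also have "\<dots> \<le> norm (?t - ?t') * (4 * R)"
    proof (rule mult_mono)
      show "norm (x (Suc k) - ?t') - norm (x (Suc k) - ?t) \<le> norm (?t - ?t')"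
        using norm_triangle_ineq2[of "x (Suc k) - ?t'" "x (Suc k) - ?t"] by simp
      show "norm (x (Suc k) - ?t') + norm (x (Suc k) - ?t) \<le> 4 * R"
        using diam[OF xX tikhonov_in, of "Suc k" "Suc k"] diam[OF xX tikhonov_in, of "Suc k" k] by simp
    qed auto
    also have "\<dots> \<le> (\<bar>\<eta> k - \<eta> (Suc k)\<bar> / \<eta> k * R) * (4 * R)"
    proof (rule mult_right_mono)
      have "norm (?t - ?t') \<le> \<bar>\<eta> k - \<eta> (Suc k)\<bar> / \<eta> k * norm ?t'"
        by (rule tikhonov_dist_le[OF mono_X pos(2) tikhonov tikhonov])
      also have "\<dots> \<le> \<bar>\<eta> k - \<eta> (Suc k)\<bar> / \<eta> k * R"
        using pos R[OF tikhonov_in] by (intro mult_left_mono) auto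
      finally show "norm (?t - ?t') \<le> \<bar>\<eta> k - \<eta> (Suc k)\<bar> / \<eta> k * R" .
    qed (use R_nonneg in simp)
    also have "\<dots> = (2 * \<gamma> k * \<eta> k) * (2 * R\<^sup>2 * (\<bar>\<eta> k - \<eta> (Suc k)\<bar> / (\<gamma> k * (\<eta> k)\<^sup>2)))"
      using pos by (simp add: field_simps power2_eq_square)
    finally have 2: "V (Suc k) - (norm (x (Suc k) - ?t))\<^sup>2 \<le>
        (2 * \<gamma> k * \<eta> k) * (2 * R\<^sup>2 * (\<bar>\<eta> k - \<eta> (Suc k)\<bar> / (\<gamma> k * (\<eta> k)\<^sup>2)))" .
    have "2 * \<gamma> k * (L * norm (z k) * (2 * R)) \<le> 2 * \<gamma> k * (L * eps k * (2 * R))"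
      using z[of k] pos lipschitz(2) R_nonneg by (intro mult_left_mono mult_right_mono) auto
    also have "\<dots> = (2 * \<gamma> k * \<eta> k) * (L * (2 * R) * (eps k / \<eta> k))" using pos by simp
    finally show ?thesis using 1 2 unfolding \<delta>_def distrib_left by linarith
  qed
  have z_lim: "z \<longlonglongrightarrow> 0"
    by (rule Lim_null_comparison[OF always_eventually eps_tendsto_0]) (use z in auto)
  \<comment> \<open>The Lipschitz bound is local, so the recursion is available only once the
    regularized solution and its shift are both close to \<open>tstar\<close>.\<close>
  have "\<forall>\<^sub>F k in sequentially. tikhonov k \<in> ball tstar \<rho>"
    using topological_tendstoD[OF tikhonov_tendsto open_ball] lipschitz(1) by auto
  moreover have "\<forall>\<^sub>F k in sequentially. tikhonov k + z k \<in> ball tstar \<rho>"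
    using topological_tendstoD[OF tendsto_add[OF tikhonov_tendsto z_lim] open_ball] lipschitz(1) by auto
  ultimately have rec': "\<forall>\<^sub>F k in sequentially.
      V (Suc k) \<le> (1 - 2 * \<gamma> k * \<eta> k) * V k + (2 * \<gamma> k * \<eta> k) * \<delta> k + w k"
    by eventually_elim (rule rec)
  have "V \<longlonglongrightarrow> 0"
  proof (rule perturbed_contraction_tendsto_0[OF _ rec'])
    show "0 \<le> V k" for k by (simp add: V_def)
    show "0 \<le> 2 * \<gamma> k * \<eta> k" for k using \<gamma>_pos[of k] \<eta>_pos[of k] by simp
    have "(\<lambda>k. 2 * \<gamma> k * \<eta> k) \<longlonglongrightarrow> 2 * 0 * 0" by (intro tendsto_intros \<gamma>_tendsto_0 \<eta>_lim)
    then show "(\<lambda>k. 2 * \<gamma> k * \<eta> k) \<longlonglongrightarrow> 0" by simp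
    show "\<not> summable (\<lambda>k. 2 * \<gamma> k * \<eta> k)"
      using \<gamma>\<eta>_not_summable summable_cmult_iff[of 2 "\<lambda>k. \<gamma> k * \<eta> k"] by (simp add: mult.assoc)
    have "\<delta> \<longlonglongrightarrow> L * (2 * R) * 0 + 2 * R\<^sup>2 * 0"
      unfolding \<delta>_def by (intro tendsto_intros eps_lim \<eta>_slow)
    then show "\<delta> \<longlonglongrightarrow> 0" by simp
    obtain H where H: "\<And>k. norm (\<eta> k) \<le> H"
      using convergent_imp_Bseq[OF convergentI[OF \<eta>_lim]] by (auto simp: Bseq_def)
    have "summable (\<lambda>k. (\<gamma> k)\<^sup>2 * ((\<eta> k)\<^sup>2 * R\<^sup>2))"
    proof (rule summable_comparison_test'[OF summable_mult2[OF \<gamma>_summable, of "H\<^sup>2 * R\<^sup>2"]])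
      show "norm ((\<gamma> k)\<^sup>2 * ((\<eta> k)\<^sup>2 * R\<^sup>2)) \<le> (\<gamma> k)\<^sup>2 * (H\<^sup>2 * R\<^sup>2)" for k
        using power_mono[OF H, of k 2] by (auto intro!: mult_left_mono mult_right_mono simp: abs_mult)
    qed
    then show "summable w"
      unfolding w_def mult.assoc using noise unfolding m_def[symmetric]
      by (intro summable_diff summable_add summable_mult)
  qed
  then have "(\<lambda>k. x k - tikhonov k) \<longlonglongrightarrow> 0"
    unfolding V_def[abs_def] by (simp add: tendsto_null_power tendsto_norm_zero_iff)
  from tendsto_add[OF this tikhonov_tendsto] show ?thesis by simp
qed

end

subsection \<open>Almost sure convergence for random samples\<close>

context regularized_scheme
begin

text \<open>Here \<open>x0\<close> and \<open>z\<close> are fixed and only the samples are random.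
  It remains to show that both noise series of \<open>iterate_tendsto\<close> converge almost
  surely: one by summing expectations, the other as a martingale.\<close>

lemma AE_iterate_tendsto:
  fixes \<Phi> :: "'a \<Rightarrow> 'b::topological_space \<Rightarrow> 'a" and xi :: "nat \<Rightarrow> 'w \<Rightarrow> 'b"
  assumes M: "prob_space M"
    and \<Phi>: "(\<lambda>(x, y). \<Phi> x y) \<in> borel_measurable (borel \<Otimes>\<^sub>M borel)"
    and xi: "prob_space.indep_vars M (\<lambda>_. borel) xi UNIV"
    and moment: "\<And>x k. x \<in> X + cball 0 \<epsilon> \<Longrightarrow> integrable M (\<lambda>\<omega>. (norm (\<Phi> x (xi k \<omega>)))\<^sup>2)"
      "\<And>x k. x \<in> X + cball 0 \<epsilon> \<Longrightarrow> (\<integral>\<omega>. (norm (\<Phi> x (xi k \<omega>)))\<^sup>2 \<partial>M) \<le> C\<^sup>2"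
    and mean: "\<And>x k. x \<in> X + cball 0 \<epsilon> \<Longrightarrow> (\<integral>\<omega>. \<Phi> x (xi k \<omega>) \<partial>M) = F x"
    and x0: "x0 \<in> X" and z: "\<And>k. norm (z k) \<le> eps k"
  shows "AE \<omega> in M. (\<lambda>k. arssa_iterate X \<Phi> \<gamma> \<eta> x0 z (\<lambda>i. xi i \<omega>) k) \<longlonglongrightarrow> tstar"
proof -
  interpret prob_space M by (rule M)
  note [measurable] = \<Phi>
  have xi_meas [measurable]: "xi k \<in> borel_measurable M" for k
    using xi unfolding indep_vars_def by auto
  define XE where "XE = X + cball 0 \<epsilon>"
  \<comment> \<open>\<open>Y k\<close> collects the samples before step \<open>k\<close> as a point
    of \<open>P k\<close>, and \<open>\<F> k\<close> is the \<sigma>-algebra it generates.\<close>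
  define P where "P k = Pi\<^sub>M {..<k} (\<lambda>_::nat. borel :: 'b measure)" for k
  define Y where "Y k \<omega> = (\<lambda>i\<in>{..<k}. xi i \<omega>)" for k \<omega>
  define \<F> where "\<F> k = vimage_algebra (space M) (Y k) (P k)" for k
  define it where "it k y = arssa_iterate X \<Phi> \<gamma> \<eta> x0 z y k" for k y
  \<comment> \<open>\<open>F\<close> is controlled only on the compact set \<open>XE\<close>;
    cutting it off there gives a bounded Borel map that agrees with it at all points
    visited.\<close>
  define G where "G x = indicator XE x *\<^sub>R F x" for x
  define m where "m k \<omega> = \<gamma> k * ((\<Phi> (it k (\<lambda>i. xi i \<omega>) + z k) (xi k \<omega>) - G (it k (\<lambda>i. xi i \<omega>) + z k))
      \<bullet> (it k (\<lambda>i. xi i \<omega>) - tikhonov k))" for k \<omega>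
  have compact_XE: "compact XE" unfolding XE_def by (rule compact_shifted)
  have G [measurable]: "G \<in> borel_measurable borel"
    unfolding G_def using cont compact_imp_closed[OF compact_XE]
    by (intro borel_measurable_continuous_on_indicator) (auto simp: XE_def)
  have it_in: "it k y \<in> X" for k y
    unfolding it_def by (rule arssa_iterate_in[OF closed_X x0])
  have shifted: "it k y + z k \<in> XE" for k y
    unfolding XE_def using z[of k] \<epsilon>(2)[of k] by (intro shift_in it_in) auto
  have G_eq: "G x = F x" if "x \<in> XE" for x using that by (simp add: G_def)
  obtain B where B: "norm (G x) \<le> B" for x
  proof -
    have "bounded (F ` XE)"
      using compact_continuous_image[OF cont, folded XE_def, OF compact_XE] by (rule compact_imp_bounded)
    then obtain B where "\<And>x. x \<in> XE \<Longrightarrow> norm (F x) \<le> B" "0 < B"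
      unfolding bounded_pos by auto
    then have "norm (G x) \<le> B" for x by (auto simp: G_def indicator_def)
    then show thesis by (rule that)
  qed
  have it_Y: "it k (Y k \<omega>) = it k (\<lambda>i. xi i \<omega>)" for k \<omega>
    unfolding it_def Y_def by (rule arssa_iterate_cong[OF _ closed_X x0]) simp
  have Y [measurable]: "Y k \<in> measurable M (P k)" for k
    unfolding Y_def P_def by measurable
  have it_P [measurable]: "it k \<in> borel_measurable (P k)" for k
  proof -
    have "(\<lambda>y. arssa_iterate X \<Phi> \<gamma> \<eta> x0 z (\<lambda>i. y i) k) \<in> borel_measurable (P k)"
      using tstar_in by (intro borel_measurable_arssa_iterate closed_X X \<Phi>) (auto simp: P_def)
    then show ?thesis by (simp add: it_def[abs_def])
  qed
  have space_\<F>: "space (\<F> k) = space M" for k by (simp add: \<F>_def)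
  have Y_\<F>: "Y k \<in> measurable (\<F> k) (P k)" for k
    unfolding \<F>_def using measurable_space[OF Y] by (intro measurable_vimage_algebra1) auto
  have xi_\<F>: "xi i \<in> borel_measurable (\<F> k)" if "i < k" for i k
  proof -
    have "(\<lambda>\<omega>. Y k \<omega> i) \<in> borel_measurable (\<F> k)"
      using that by (intro measurable_compose[OF Y_\<F>]) (auto simp: P_def)
    then show ?thesis using that by (simp add: Y_def)
  qed
  \<comment> \<open>The current sample is packed as a family over a one-point index set, because
    independence is obtained by restricting the family to the disjoint sets \<open>{..<k}\<close>
    and \<open>{k}\<close>.\<close>
  define P' where "P' k = Pi\<^sub>M {k} (\<lambda>_::nat. borel :: 'b measure)" for k
  define Z where "Z k \<omega> = (\<lambda>i\<in>{k}. xi i \<omega>)" for k \<omega>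
  have Z_k: "Z k \<omega> k = xi k \<omega>" for k \<omega> by (simp add: Z_def)
  have [measurable]: "(\<lambda>e. e k) \<in> borel_measurable (P' k)" for k
    unfolding P'_def by (rule measurable_component_singleton) simp
  have indep: "indep_var (P k) (Y k) (P' k) (Z k)" for k
    unfolding P_def P'_def Y_def Z_def by (rule indep_var_restrict[OF xi]) auto
  \<comment> \<open>The moment bound is given at deterministic points only. With the past frozen at
    \<open>y\<close> the evaluation point \<open>it k y + z k\<close> is deterministic.\<close>
  have second_moment: "(\<integral>\<^sup>+\<omega>. ennreal ((norm (\<Phi> (it k (\<lambda>i. xi i \<omega>) + z k) (xi k \<omega>)))\<^sup>2) \<partial>M) \<le> ennreal (C\<^sup>2)" for k
  proof -
    define f where "f = (\<lambda>(y, e). ennreal ((norm (\<Phi> (it k y + z k) (e k)))\<^sup>2))"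
    have "(\<integral>\<^sup>+\<omega>. f (Y k \<omega>, Z k \<omega>) \<partial>M) \<le> ennreal (C\<^sup>2)"
    proof (rule indep_var_nn_integral_le[OF indep])
      show "f \<in> borel_measurable (P k \<Otimes>\<^sub>M P' k)" unfolding f_def by measurable
      show "(\<integral>\<^sup>+\<omega>. f (y, Z k \<omega>) \<partial>M) \<le> ennreal (C\<^sup>2)" for y
        using moment[folded XE_def, OF shifted[of k y]]
        by (simp add: f_def Z_k nn_integral_eq_integral ennreal_leI)
    qed
    then show ?thesis by (simp add: f_def it_Y Z_k)
  qed
  have q_meas [measurable]: "(\<lambda>\<omega>. \<Phi> (it k (\<lambda>i. xi i \<omega>) + z k) (xi k \<omega>)) \<in> borel_measurable M" for k
    unfolding it_Y[symmetric] by measurable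
  have q_int: "integrable M (\<lambda>\<omega>. (norm (\<Phi> (it k (\<lambda>i. xi i \<omega>) + z k) (xi k \<omega>)))\<^sup>2)" for k
    using second_moment[of k] by (intro integrableI_bounded) (auto simp: less_top[symmetric] top_unique)
  have q_moment: "(\<integral>\<omega>. (norm (\<Phi> (it k (\<lambda>i. xi i \<omega>) + z k) (xi k \<omega>)))\<^sup>2 \<partial>M) \<le> C\<^sup>2" for k
    using second_moment[of k] q_int[of k] by (simp add: nn_integral_eq_integral)
  have m_bound: "(m k \<omega>)\<^sup>2 \<le>
      (\<gamma> k)\<^sup>2 * ((2 * (norm (\<Phi> (it k (\<lambda>i. xi i \<omega>) + z k) (xi k \<omega>)))\<^sup>2 + 2 * B\<^sup>2) * (2 * R)\<^sup>2)" for k \<omega>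
  proof -
    let ?x = "it k (\<lambda>i. xi i \<omega>)"
    let ?q = "\<Phi> (?x + z k) (xi k \<omega>)" and ?g = "G (?x + z k)"
    have "\<bar>(?q - ?g) \<bullet> (?x - tikhonov k)\<bar> \<le> norm (?q - ?g) * norm (?x - tikhonov k)"
      by (rule Cauchy_Schwarz_ineq2)
    also have "\<dots> \<le> (norm ?q + B) * (2 * R)"
      using norm_triangle_ineq4[of ?q ?g] B[of "?x + z k"]
        order_trans[OF norm_ge_zero B[of 0]]
      by (intro mult_mono diam it_in tikhonov_in) auto
    finally have "\<bar>(?q - ?g) \<bullet> (?x - tikhonov k)\<bar>\<^sup>2 \<le> ((norm ?q + B) * (2 * R))\<^sup>2"
      by (intro power_mono) auto
    also have "\<dots> \<le> (2 * (norm ?q)\<^sup>2 + 2 * B\<^sup>2) * (2 * R)\<^sup>2"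
      unfolding power_mult_distrib[of "norm ?q + B"] using sum_squares_bound[of "norm ?q" B]
      by (intro mult_right_mono) (auto simp: power2_sum)
    finally show ?thesis
      unfolding m_def power_mult_distrib[of "\<gamma> k"] power2_abs by (intro mult_left_mono) auto
  qed
  have m_meas: "m k \<in> borel_measurable A" if "\<And>i. i \<le> k \<Longrightarrow> xi i \<in> borel_measurable A" for A k
  proof -
    have [measurable]: "(\<lambda>\<omega>. it k (\<lambda>i. xi i \<omega>)) \<in> borel_measurable A"
      unfolding it_def using tstar_in that by (intro borel_measurable_arssa_iterate closed_X X \<Phi>) auto
    have [measurable]: "xi k \<in> borel_measurable A" using that by simp
    show ?thesis unfolding m_def by measurable
  qed
  have m_M [measurable]: "m k \<in> borel_measurable M" for k by (rule m_meas) measurable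
  have m_sq: "integrable M (\<lambda>\<omega>. (m k \<omega>)\<^sup>2)" for k
  proof (rule Bochner_Integration.integrable_bound)
    show "integrable M (\<lambda>\<omega>. (\<gamma> k)\<^sup>2 *
        ((2 * (norm (\<Phi> (it k (\<lambda>i. xi i \<omega>) + z k) (xi k \<omega>)))\<^sup>2 + 2 * B\<^sup>2) * (2 * R)\<^sup>2))"
      using q_int[of k] by simp
  qed (use m_bound in \<open>auto simp del: power_mult_distrib intro: order_trans[OF _ abs_ge_self]\<close>)
  have m_int: "integrable M (m k)" for k
    using integrable_mult_of_squares[OF m_M[of k] borel_measurable_const[of 1] m_sq[of k]] by simp
  have \<Phi>_int: "integrable M (\<lambda>\<omega>. \<Phi> x (xi k \<omega>))" if "x \<in> XE" for x k
  proof (rule Bochner_Integration.integrable_bound)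
    show "integrable M (\<lambda>\<omega>. 1 + (norm (\<Phi> x (xi k \<omega>)))\<^sup>2)"
      using moment(1)[folded XE_def, OF that] by simp
    show "AE \<omega> in M. norm (\<Phi> x (xi k \<omega>)) \<le> norm (1 + (norm (\<Phi> x (xi k \<omega>)))\<^sup>2)"
    proof (rule AE_I2)
      fix \<omega>
      show "norm (\<Phi> x (xi k \<omega>)) \<le> norm (1 + (norm (\<Phi> x (xi k \<omega>)))\<^sup>2)"
        using sum_squares_bound[of 1 "norm (\<Phi> x (xi k \<omega>))"] norm_ge_zero[of "\<Phi> x (xi k \<omega>)"]
        by (simp del: norm_ge_zero)
    qed
  qed measurable
  have subalg: "subalgebra M (\<F> k)" for k
    unfolding subalgebra_def using sets_image_in_sets[OF refl Y[of k]] by (simp add: \<F>_def)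
  have cond: "AE \<omega> in M. real_cond_exp M (\<F> k) (m k) \<omega> = 0" for k
  proof -
    interpret finite_measure_subalgebra M "\<F> k"
      using subalg by unfold_locales
    show ?thesis
    proof (rule real_cond_exp_charact[OF _ m_int])
      fix A assume "A \<in> sets (\<F> k)"
      then obtain D where D [measurable]: "D \<in> sets (P k)" and A: "A = Y k -` D \<inter> space M"
        unfolding \<F>_def using sets_vimage_algebra2[of "Y k" "space M" "P k"] measurable_space[OF Y]
        by auto
      \<comment> \<open>An event of \<open>\<F> k\<close> is a condition \<open>D\<close> on the
        past, so its indicator freezes together with the iterate. What remains for fixed
        \<open>y\<close> is \<open>\<Phi>\<close> minus its mean, paired with a constant
        vector.\<close>
      define f where "f = (\<lambda>(y, e). indicator D y *
          (\<gamma> k * ((\<Phi> (it k y + z k) (e k) - G (it k y + z k)) \<bullet> (it k y - tikhonov k))))"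
      have f_eq: "f (Y k \<omega>, Z k \<omega>) = indicator A \<omega> * m k \<omega>" if "\<omega> \<in> space M" for \<omega>
        using that by (simp add: f_def m_def it_Y Z_k A indicator_def)
      have "(\<integral>\<omega>. f (Y k \<omega>, Z k \<omega>) \<partial>M) = 0"
      proof (rule indep_var_integral_eq_0[OF indep])
        show "f \<in> borel_measurable (P k \<Otimes>\<^sub>M P' k)" unfolding f_def by measurable
        have "A \<in> sets M" unfolding A by measurable
        then have "integrable M (\<lambda>\<omega>. indicator A \<omega> * m k \<omega>)"
          using integrable_mult_indicator[OF _ m_int] by simp
        then show "integrable M (\<lambda>\<omega>. f (Y k \<omega>, Z k \<omega>))"
          using f_eq by (subst Bochner_Integration.integrable_cong[OF refl]) auto
        show "(\<integral>\<omega>. f (y, Z k \<omega>) \<partial>M) = 0" for y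
          using mean[folded XE_def, OF shifted[of k y]] G_eq[OF shifted[of k y]]
            \<Phi>_int[OF shifted[of k y]]
          by (simp add: f_def Z_k prob_space)
      qed
      then have "(\<integral>\<omega>. indicator A \<omega> * m k \<omega> \<partial>M) = 0"
        using f_eq by (simp cong: Bochner_Integration.integral_cong)
      then show "(LINT \<omega>:A|M. m k \<omega>) = (LINT \<omega>:A|M. 0)"
        by (simp add: set_lebesgue_integral_def)
    qed auto
  qed
  interpret md: square_integrable_martingale_differences M \<F> m
  proof
    show "subalgebra (\<F> j) (\<F> i)" if "i \<le> j" for i j
    proof -
      have "Y i \<in> measurable (\<F> j) (P i)"
        unfolding Y_def[abs_def] P_def using xi_\<F> that by (intro measurable_restrict) auto
      then show ?thesis
        unfolding subalgebra_def using sets_image_in_sets[OF space_\<F>[of j]] space_\<F> by (simp add: \<F>_def)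
    qed
    show "m k \<in> borel_measurable (\<F> (Suc k))" for k
      using xi_\<F> by (intro m_meas) auto
  qed (use subalg m_sq cond in auto)
  have "summable (\<lambda>k. \<integral>\<omega>. (m k \<omega>)\<^sup>2 \<partial>M)"
  proof (rule summable_comparison_test'[OF summable_mult2[OF \<gamma>_summable, of "(2 * C\<^sup>2 + 2 * B\<^sup>2) * (2 * R)\<^sup>2"]])
    fix k
    have "(\<integral>\<omega>. (m k \<omega>)\<^sup>2 \<partial>M) \<le> (\<integral>\<omega>. (\<gamma> k)\<^sup>2 *
        ((2 * (norm (\<Phi> (it k (\<lambda>i. xi i \<omega>) + z k) (xi k \<omega>)))\<^sup>2 + 2 * B\<^sup>2) * (2 * R)\<^sup>2) \<partial>M)"
      using q_int[of k] by (intro integral_mono m_sq m_bound) auto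
    also have "\<dots> = (\<gamma> k)\<^sup>2 * ((2 * (\<integral>\<omega>. (norm (\<Phi> (it k (\<lambda>i. xi i \<omega>) + z k) (xi k \<omega>)))\<^sup>2 \<partial>M) + 2 * B\<^sup>2) * (2 * R)\<^sup>2)"
      using q_int[of k] by (simp add: prob_space)
    also have "\<dots> \<le> (\<gamma> k)\<^sup>2 * ((2 * C\<^sup>2 + 2 * B\<^sup>2) * (2 * R)\<^sup>2)"
      using q_moment[of k] by (intro mult_left_mono mult_right_mono) auto
    finally show "norm (\<integral>\<omega>. (m k \<omega>)\<^sup>2 \<partial>M) \<le> (\<gamma> k)\<^sup>2 * ((2 * C\<^sup>2 + 2 * B\<^sup>2) * (2 * R)\<^sup>2)"
      by simp
  qed
  then have AE1: "AE \<omega> in M. summable (\<lambda>k. m k \<omega>)" by (rule md.AE_summable)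
  have AE2: "AE \<omega> in M. summable (\<lambda>k. (\<gamma> k)\<^sup>2 * (norm (\<Phi> (it k (\<lambda>i. xi i \<omega>) + z k) (xi k \<omega>)))\<^sup>2)"
  proof -
    let ?h = "\<lambda>k \<omega>. (\<gamma> k)\<^sup>2 * (norm (\<Phi> (it k (\<lambda>i. xi i \<omega>) + z k) (xi k \<omega>)))\<^sup>2"
    \<comment> \<open>The terms are nonnegative, so a finite sum of expectations already makes the
      random series finite almost surely.\<close>
    have "(\<integral>\<^sup>+\<omega>. (\<Sum>k. ennreal (?h k \<omega>)) \<partial>M) = (\<Sum>k. \<integral>\<^sup>+\<omega>. ennreal (?h k \<omega>) \<partial>M)"
      by (rule nn_integral_suminf) measurable
    also have "\<dots> \<le> (\<Sum>k. ennreal ((\<gamma> k)\<^sup>2 * C\<^sup>2))"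
    proof (rule suminf_le)
      fix k
      have "(\<integral>\<^sup>+\<omega>. ennreal (?h k \<omega>) \<partial>M) = ennreal (\<integral>\<omega>. ?h k \<omega> \<partial>M)"
        using q_int[of k] by (intro nn_integral_eq_integral) auto
      also have "\<dots> \<le> ennreal ((\<gamma> k)\<^sup>2 * C\<^sup>2)"
        using q_moment[of k] by (intro ennreal_leI) (auto intro: mult_left_mono)
      finally show "(\<integral>\<^sup>+\<omega>. ennreal (?h k \<omega>) \<partial>M) \<le> ennreal ((\<gamma> k)\<^sup>2 * C\<^sup>2)" .
    qed auto
    also have "\<dots> = ennreal (\<Sum>k. (\<gamma> k)\<^sup>2 * C\<^sup>2)"
      using summable_mult2[OF \<gamma>_summable] by (intro suminf_ennreal2) auto
    finally have "(\<integral>\<^sup>+\<omega>. (\<Sum>k. ennreal (?h k \<omega>)) \<partial>M) \<noteq> \<infinity>"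
      by (auto simp: top_unique)
    then have "AE \<omega> in M. (\<Sum>k. ennreal (?h k \<omega>)) \<noteq> \<infinity>"
      by (intro nn_integral_PInf_AE) auto
    then show ?thesis
      by eventually_elim (auto intro!: summable_suminf_not_top)
  qed
  show ?thesis using AE1 AE2
  proof eventually_elim
    case (elim \<omega>)
    have "summable (\<lambda>k. \<gamma> k * ((\<Phi> (it k (\<lambda>i. xi i \<omega>) + z k) (xi k \<omega>) - F (it k (\<lambda>i. xi i \<omega>) + z k))
      \<bullet> (it k (\<lambda>i. xi i \<omega>) - tikhonov k)))"
      using elim(1) by (simp add: m_def G_eq[OF shifted])
    from iterate_tendsto[OF x0 z _ _ elim(2) this, where \<Phi>=\<Phi> and xi="\<lambda>i. xi i \<omega>"]
    show ?case by (simp add: it_def)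
  qed
qed

end

subsection \<open>Joint measurability, independence and step sizes\<close>

text \<open>Bernoulli's inequality \<open>1 - b / u \<le> (1 + 1 / u) powr (- b)\<close>, from
  \<open>ln (1 + x) \<le> x\<close> and \<open>1 + x \<le> exp x\<close>, multiplied by
  \<open>u powr (- b)\<close>.\<close>

lemma powr_decrement_le:
  assumes "0 < (u::real)" "0 < b"
  shows "u powr (- b) - (u + 1) powr (- b) \<le> b * u powr (- b - 1)"
proof -
  have "1 - b / u \<le> 1 - b * ln (1 + 1 / u)"
    using mult_left_mono[OF ln_add_one_self_le_self[of "1 / u"], of b] assms by simp
  also have "\<dots> \<le> exp (- b * ln (1 + 1 / u))"
    using exp_ge_add_one_self[of "- b * ln (1 + 1 / u)"] by simp
  also have "\<dots> = (1 + 1 / u) powr (- b)"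
    using assms add_pos_pos[of 1 "1 / u"] by (simp add: powr_def)
  finally have "u powr (- b) * (1 - b / u) \<le> u powr (- b) * (1 + 1 / u) powr (- b)"
    by (intro mult_left_mono) auto
  also have "\<dots> = (u * (1 + 1 / u)) powr (- b)"
    using assms by (intro powr_mult[symmetric])
  also have "u * (1 + 1 / u) = u + 1" using assms by (simp add: field_simps)
  finally show ?thesis using assms by (simp add: powr_diff field_simps)
qed

lemma pred_tendsto:
  fixes f :: "nat \<Rightarrow> 'a \<Rightarrow> 'b::{second_countable_topology, real_normed_vector}"
  assumes [measurable]: "\<And>n. f n \<in> borel_measurable M"
  shows "Measurable.pred M (\<lambda>x. (\<lambda>n. f n x) \<longlonglongrightarrow> l)"
proof -
  have "(\<lambda>n. f n x) \<longlonglongrightarrow> l \<longleftrightarrow> (\<forall>i. \<exists>N. \<forall>n. N \<le> n \<longrightarrow> norm (f n x - l) < inverse (real (Suc i)))" for x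
  proof
    assume "(\<lambda>n. f n x) \<longlonglongrightarrow> l"
    then show "\<forall>i. \<exists>N. \<forall>n. N \<le> n \<longrightarrow> norm (f n x - l) < inverse (real (Suc i))"
      unfolding LIMSEQ_iff by simp
  next
    assume *: "\<forall>i. \<exists>N. \<forall>n. N \<le> n \<longrightarrow> norm (f n x - l) < inverse (real (Suc i))"
    show "(\<lambda>n. f n x) \<longlonglongrightarrow> l"
      unfolding LIMSEQ_iff
    proof (intro allI impI)
      fix e :: real assume "0 < e"
      then obtain i where "inverse (real (Suc i)) < e" using reals_Archimedean by blast
      with * show "\<exists>N. \<forall>n\<ge>N. norm (f n x - l) < e" by (meson less_trans)
    qed
  qed
  then show ?thesis by simp
qed

section \<open>Grouping independent variables\<close>

lemma Int_stable_vimage: "Int_stable {X -` A \<inter> S |A. A \<in> sets N}"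
proof (rule Int_stableI)
  fix a b assume "a \<in> {X -` A \<inter> S |A. A \<in> sets N}" "b \<in> {X -` A \<inter> S |A. A \<in> sets N}"
  then obtain A B where "A \<in> sets N" "B \<in> sets N" "a = X -` A \<inter> S" "b = X -` B \<inter> S"
    by auto
  then show "a \<inter> b \<in> {X -` A \<inter> S |A. A \<in> sets N}"
    by (intro CollectI exI[of _ "A \<inter> B"]) auto
qed

text \<open>The first and third variables (initial point and perturbations) are grouped against the
  second (samples), so that Fubini's theorem can freeze the pair. Equality of the laws is checked on
  rectangles.\<close>

lemma (in prob_space) indep_vars3_distr_pair:
  assumes "indep_vars3 M N1 X1 N2 X2 N3 X3"
  shows "distr M (N1 \<Otimes>\<^sub>M N3) (\<lambda>\<omega>. (X1 \<omega>, X3 \<omega>)) \<Otimes>\<^sub>M distr M N2 X2 =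
    distr M ((N1 \<Otimes>\<^sub>M N3) \<Otimes>\<^sub>M N2) (\<lambda>\<omega>. ((X1 \<omega>, X3 \<omega>), X2 \<omega>))"
proof -
  define E where "E = (\<lambda>i. [{X1 -` A \<inter> space M |A. A \<in> sets N1},
             {X2 -` A \<inter> space M |A. A \<in> sets N2},
             {X3 -` A \<inter> space M |A. A \<in> sets N3}] ! i)"
  have X [measurable]: "X1 \<in> measurable M N1" "X2 \<in> measurable M N2" "X3 \<in> measurable M N3"
    and E_ind: "indep_sets E {..<3}"
    using assms by (auto simp: indep_vars3_def E_def)
  have E_simps: "E 0 = {X1 -` A \<inter> space M |A. A \<in> sets N1}"
      "E 1 = {X2 -` A \<inter> space M |A. A \<in> sets N2}" "E 2 = {X3 -` A \<inter> space M |A. A \<in> sets N3}"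
    by (simp_all add: E_def)
  define I where "I = case_bool {0, 2} {1::nat}"
  have I_un: "(\<Union>j\<in>UNIV. I j) = {..<3}" by (auto simp: I_def UNIV_bool)
  have "indep_sets (\<lambda>j. sigma_sets (space M) (\<Union>i\<in>I j. E i)) UNIV"
  proof (rule indep_sets_collect_sigma)
    show "indep_sets E (\<Union>j\<in>UNIV. I j)" using E_ind unfolding I_un .
    show "disjoint_family I" by (auto simp: disjoint_family_on_def I_def split: bool.split)
    show "Int_stable (E i)" if "i \<in> I j" for i j
      using that by (auto simp: I_def E_simps E_simps(2)[simplified] Int_stable_vimage split: bool.splits)
  qed
  moreover have "(\<lambda>j. sigma_sets (space M) (\<Union>i\<in>I j. E i)) =
      case_bool (sigma_sets (space M) (E 0 \<union> E 2)) (sigma_sets (space M) (E 1))"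
    by (auto simp: I_def fun_eq_iff split: bool.split)
  ultimately have ind: "indep_set (sigma_sets (space M) (E 0 \<union> E 2)) (sigma_sets (space M) (E 1))"
    by (simp add: indep_set_def)
  let ?W = "\<lambda>\<omega>. (X1 \<omega>, X3 \<omega>)"
  \<comment> \<open>Both coordinates are measurable for the \<sigma>-algebra generated by
    \<open>E 0\<close> and \<open>E 2\<close>, hence so is the pair; this covers all sets of the
    product, not only rectangles.\<close>
  have W_in: "?W -` A \<inter> space M \<in> sigma_sets (space M) (E 0 \<union> E 2)" if "A \<in> sets (N1 \<Otimes>\<^sub>M N3)" for A
  proof -
    define S where "S = sigma (space M) (E 0 \<union> E 2)"
    have pow: "E 0 \<union> E 2 \<subseteq> Pow (space M)" by (auto simp: E_simps)
    have "?W \<in> measurable S (N1 \<Otimes>\<^sub>M N3)"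
    proof (rule measurable_Pair)
      show "X1 \<in> measurable S N1"
      proof (rule measurableI)
        fix A assume "A \<in> sets N1"
        then have "X1 -` A \<inter> space M \<in> E 0 \<union> E 2" unfolding E_simps by blast
        then show "X1 -` A \<inter> space S \<in> sets S"
          unfolding S_def space_measure_of[OF pow] sets_measure_of[OF pow] by (rule sigma_sets.Basic)
      qed (use measurable_space[OF X(1)] in \<open>simp add: S_def space_measure_of[OF pow]\<close>)
      show "X3 \<in> measurable S N3"
      proof (rule measurableI)
        fix A assume "A \<in> sets N3"
        then have "X3 -` A \<inter> space M \<in> E 0 \<union> E 2" unfolding E_simps by blast
        then show "X3 -` A \<inter> space S \<in> sets S"
          unfolding S_def space_measure_of[OF pow] sets_measure_of[OF pow] by (rule sigma_sets.Basic)
      qed (use measurable_space[OF X(3)] in \<open>simp add: S_def space_measure_of[OF pow]\<close>)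
    qed
    from measurable_sets[OF this that] show ?thesis
      unfolding S_def space_measure_of[OF pow] sets_measure_of[OF pow] .
  qed
  interpret W: prob_space "distr M (N1 \<Otimes>\<^sub>M N3) ?W" by (rule prob_space_distr) measurable
  interpret V: prob_space "distr M N2 X2" by (rule prob_space_distr) measurable
  show ?thesis
  proof (rule pair_measure_eqI)
    fix A B assume "A \<in> sets (distr M (N1 \<Otimes>\<^sub>M N3) ?W)" "B \<in> sets (distr M N2 X2)"
    then have AB [measurable]: "A \<in> sets (N1 \<Otimes>\<^sub>M N3)" "B \<in> sets N2" by simp_all
    have eq: "(\<lambda>\<omega>. (?W \<omega>, X2 \<omega>)) -` (A \<times> B) \<inter> space M =
        (?W -` A \<inter> space M) \<inter> (X2 -` B \<inter> space M)" by auto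
    have "X2 -` B \<inter> space M \<in> sigma_sets (space M) (E 1)"
      using AB(2) unfolding E_simps by blast
    from indep_setD[OF ind W_in[OF AB(1)] this]
    have "prob ((\<lambda>\<omega>. (?W \<omega>, X2 \<omega>)) -` (A \<times> B) \<inter> space M) =
        prob (?W -` A \<inter> space M) * prob (X2 -` B \<inter> space M)"
      by (simp only: eq)
    then show "emeasure (distr M (N1 \<Otimes>\<^sub>M N3) ?W) A * emeasure (distr M N2 X2) B =
        emeasure (distr M ((N1 \<Otimes>\<^sub>M N3) \<Otimes>\<^sub>M N2) (\<lambda>\<omega>. (?W \<omega>, X2 \<omega>))) (A \<times> B)"
      by (simp add: emeasure_distr emeasure_eq_measure ennreal_mult[symmetric])
  next
    show "sigma_finite_measure (distr M (N1 \<Otimes>\<^sub>M N3) ?W)" "sigma_finite_measure (distr M N2 X2)" ..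
  qed simp
qed

text \<open>Exponent count: the squared steps are summable as \<open>2 * a > 1\<close>, the rate has
  exponent \<open>- (a + b) > - 1\<close>, and the smoothing ratio has exponent
  \<open>b - c < 0\<close>. The drift ratio compares exponent \<open>- b - 1\<close> with
  \<open>- a - 2 * b\<close>, leaving \<open>a + b - 1 < 0\<close>.\<close>

lemma regularized_scheme_powr:
  fixes X :: "'a::euclidean_space set"
  assumes "compact X" "convex X" "0 < \<epsilon>" "\<And>k. eps k \<le> \<epsilon>"
    "monotone_map_on (X + cball 0 \<epsilon>) F" "continuous_on (X + cball 0 \<epsilon>) F"
    "is_arg_min norm (\<lambda>s. s \<in> VI_solutions X F) tstar" "0 < \<rho>" "0 \<le> L"
    "\<And>x y. x \<in> ball tstar \<rho> \<Longrightarrow> y \<in> ball tstar \<rho> \<Longrightarrow> norm (F x - F y) \<le> L * norm (x - y)"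
    and pos: "0 < g" "0 < h"
    and \<gamma>: "\<And>k. \<gamma> k = g * real (k + 1) powr (- a)"
    and \<eta>: "\<And>k. \<eta> k = h * real (k + 1) powr (- b)"
    and eps: "\<And>k. eps k = e * real (k + 1) powr (- c)"
    and exponents: "1 / 2 < a" "0 < b" "a + b < 1" "b < c"
  shows "regularized_scheme X \<epsilon> F tstar \<gamma> \<eta> eps \<rho> L"
proof
  have lim: "(\<lambda>k. real (k + 1) powr s) \<longlonglongrightarrow> 0" if "s < 0" for s
    by (rule tendsto_neg_powr[OF that]) (intro filterlim_compose[OF filterlim_real_sequentially], rule filterlim_add_const_nat_at_top)
  show "0 < \<gamma> k" "0 < \<eta> k" for k using pos by (simp_all add: \<gamma> \<eta>)
  show "\<eta> \<longlonglongrightarrow> 0"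
    using tendsto_mult_right_zero[OF lim[of "- b"], of h] exponents by (simp add: \<eta>[abs_def])
  have "(\<gamma> k)\<^sup>2 = g\<^sup>2 * real (k + 1) powr (- 2 * a)" for k
    by (simp add: \<gamma> power_mult_distrib powr_power)
  moreover have "summable (\<lambda>k. real (k + 1) powr (- 2 * a))"
    using exponents summable_iff_shift[of "\<lambda>n. real n powr (- 2 * a)" 1]
    by (simp add: summable_real_powr_iff)
  ultimately show "summable (\<lambda>k. (\<gamma> k)\<^sup>2)" by (simp add: summable_mult)
  have "\<gamma> k * \<eta> k = (g * h) * real (k + 1) powr (- (a + b))" for k
    by (simp add: \<gamma> \<eta> powr_add[symmetric])
  then show "\<not> summable (\<lambda>k. \<gamma> k * \<eta> k)"
    using not_summable_powr_ge[of "- (a + b)"] exponents pos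
      summable_cmult_iff[of "g * h" "\<lambda>k. real (k + 1) powr (- (a + b))"] by auto
  have "eps k / \<eta> k = e / h * real (k + 1) powr (b - c)" for k
    using pos by (simp add: eps \<eta> powr_diff powr_minus field_simps)
  then show "(\<lambda>k. eps k / \<eta> k) \<longlonglongrightarrow> 0"
    using tendsto_mult_right_zero[OF lim[of "b - c"], of "e / h"] exponents by simp
  show "(\<lambda>k. \<bar>\<eta> k - \<eta> (Suc k)\<bar> / (\<gamma> k * (\<eta> k)\<^sup>2)) \<longlonglongrightarrow> 0"
  proof (rule Lim_null_comparison[OF always_eventually])
    show "(\<lambda>k. b / (g * h) * real (k + 1) powr (a + b - 1)) \<longlonglongrightarrow> 0"
      using tendsto_mult_right_zero[OF lim[of "a + b - 1"], of "b / (g * h)"] exponents by simp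
    show "\<forall>k. norm (\<bar>\<eta> k - \<eta> (Suc k)\<bar> / (\<gamma> k * (\<eta> k)\<^sup>2)) \<le> b / (g * h) * real (k + 1) powr (a + b - 1)"
    proof
      fix k
      define u where "u = real (k + 1)"
      have u: "0 < u" "real (Suc k + 1) = u + 1" by (simp_all add: u_def)
      have dec: "(u + 1) powr (- b) \<le> u powr (- b)" using u exponents by (intro powr_mono2') auto
      have "\<bar>\<eta> k - \<eta> (Suc k)\<bar> = h * (u powr (- b) - (u + 1) powr (- b))"
        using pos mult_left_mono[OF dec, of h] unfolding \<eta> u(2) u_def[symmetric] by (simp add: algebra_simps)
      also have "\<dots> \<le> h * (b * u powr (- b - 1))"
        using powr_decrement_le[OF u(1) exponents(2)] pos by (intro mult_left_mono) auto
      finally have "\<bar>\<eta> k - \<eta> (Suc k)\<bar> / (\<gamma> k * (\<eta> k)\<^sup>2) \<le> h * (b * u powr (- b - 1)) / (\<gamma> k * (\<eta> k)\<^sup>2)"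
        using pos by (intro divide_right_mono) (simp_all add: \<gamma>)
      also have "\<dots> = b / (g * h) * u powr (a + b - 1)"
      proof -
        have u_powr: "u powr (a + b - 1) = u powr (- b - 1) / (u powr (- a) * (u powr (- b))\<^sup>2)"
          using u by (simp add: powr_power powr_add[symmetric] powr_diff[symmetric] algebra_simps)
        show ?thesis unfolding u_powr \<gamma> \<eta> u_def[symmetric] using pos u
          by (simp add: field_simps power2_eq_square)
      qed
      finally show "norm (\<bar>\<eta> k - \<eta> (Suc k)\<bar> / (\<gamma> k * (\<eta> k)\<^sup>2)) \<le> b / (g * h) * real (k + 1) powr (a + b - 1)"
        using pos by (simp add: u_def \<gamma>)
    qed
  qed
qed (use assms in auto)

section \<open>Almost sure convergence of the averages\<close>

theorem proposition5:
  fixes M :: "'w measure"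
    and X X\<epsilon> :: "(real ^ 'n) set"
    and \<Phi> :: "real ^ 'n \<Rightarrow> real ^ 'd \<Rightarrow> real ^ 'n"
    and F :: "real ^ 'n \<Rightarrow> real ^ 'n"
    and \<xi> :: "'w \<Rightarrow> real ^ 'd"
    and xi :: "nat \<Rightarrow> 'w \<Rightarrow> real ^ 'd"
    and z :: "nat \<Rightarrow> 'w \<Rightarrow> real ^ 'n"
    and x0 :: "'w \<Rightarrow> real ^ 'n"
    and tstar :: "real ^ 'n"
    and \<gamma> \<eta> eps :: "nat \<Rightarrow> real"
    and \<epsilon> \<gamma>0 \<eta>0 \<epsilon>0 a b c r C :: real
  assumes M: "prob_space M"
    and X: "closed X" "bounded X" "convex X"
    and eps_bound: "\<epsilon> > 0" "\<And>k. eps k \<le> \<epsilon>"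
    and X\<epsilon>: "X\<epsilon> = X + cball 0 \<epsilon>"
    and \<xi>: "\<xi> \<in> borel_measurable M"
    and \<Phi>: "(\<lambda>(x, y). \<Phi> x y) \<in> borel_measurable
              (restrict_space (borel \<Otimes>\<^sub>M borel) (X\<epsilon> \<times> UNIV))"
    and moment: "C > 0"
      "\<And>x. x \<in> X\<epsilon> \<Longrightarrow> integrable M (\<lambda>\<omega>. (norm (\<Phi> x (\<xi> \<omega>)))\<^sup>2)"
      "\<And>x. x \<in> X\<epsilon> \<Longrightarrow> (\<integral>\<omega>. (norm (\<Phi> x (\<xi> \<omega>)))\<^sup>2 \<partial>M) \<le> C\<^sup>2"
    and F: "\<And>x. x \<in> X\<epsilon> \<Longrightarrow> F x = (\<integral>\<omega>. \<Phi> x (\<xi> \<omega>) \<partial>M)"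
    and F_mono: "monotone_map_on X\<epsilon> F"
    and F_cont: "continuous_on X\<epsilon> F"
    and solvable: "VI_solutions X F \<noteq> {}"
    and tstar: "is_arg_min norm (\<lambda>s. s \<in> VI_solutions X F) tstar"
    and F_diff: "F differentiable (at tstar)"
    and F_jacobian: "\<exists>B. \<forall>\<^sub>F x in nhds tstar. F differentiable (at x) \<and> norm (jacobian F (at x)) \<le> B"
    and constants: "\<gamma>0 > 0" "\<eta>0 > 0" "\<epsilon>0 > 0"
    and \<gamma>: "\<And>k. \<gamma> k = \<gamma>0 * real (k + 1) powr (- a)"
    and \<eta>: "\<And>k. \<eta> k = \<eta>0 * real (k + 1) powr (- b)"
    and eps: "\<And>k. eps k = \<epsilon>0 * real (k + 1) powr (- c)"
    and exponents: "a > 0" "b > 0" "c > 0" "a > 1 / 2" "a + 3 * b < 1" "b + 2 * c < a" "b < c"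
      "r \<le> 1 / a"
    and xi_indep: "prob_space.indep_vars M (\<lambda>_. borel) xi UNIV"
    and xi_distr: "\<And>k. distr M borel (xi k) = distr M borel \<xi>"
    and z_indep: "prob_space.indep_vars M (\<lambda>_. borel) z UNIV"
    and z_distr: "\<And>k. distr M borel (z k) = uniform_measure lborel (cball 0 (eps k))"
    and x0: "\<And>\<omega>. \<omega> \<in> space M \<Longrightarrow> x0 \<omega> \<in> X"
      "integrable M (\<lambda>\<omega>. (norm (x0 \<omega>))\<^sup>2)"
    and indep: "indep_vars3 M borel x0
                  (Pi\<^sub>M UNIV (\<lambda>_. borel)) (\<lambda>\<omega> j. xi j \<omega>)
                  (Pi\<^sub>M UNIV (\<lambda>_. borel)) (\<lambda>\<omega> i. z i \<omega>)"
  shows "AE \<omega> in M.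
    (\<lambda>k. arssa_average r X \<Phi> \<gamma> \<eta> (x0 \<omega>) (\<lambda>i. z i \<omega>) (\<lambda>j. xi j \<omega>) k) \<longlonglongrightarrow> tstar"
proof -
  interpret prob_space M by (rule M)
  have cX: "compact X" using X by (simp add: compact_eq_bounded_closed)
  obtain B where "\<forall>\<^sub>F x in nhds tstar. F differentiable (at x) \<and> norm (jacobian F (at x)) \<le> B"
    using F_jacobian by blast
  then obtain \<rho> L where lip: "0 < \<rho>" "0 \<le> L"
    "\<And>x y. x \<in> ball tstar \<rho> \<Longrightarrow> y \<in> ball tstar \<rho> \<Longrightarrow> norm (F x - F y) \<le> L * norm (x - y)"
    by (rule bounded_jacobian_imp_lipschitz) blast
  interpret rs: regularized_scheme X \<epsilon> F tstar \<gamma> \<eta> eps \<rho> L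
    by (rule regularized_scheme_powr[where g=\<gamma>0 and h=\<eta>0 and e=\<epsilon>0 and a=a and b=b and c=c])
      (use cX X eps_bound F_mono F_cont X\<epsilon> tstar lip constants \<gamma> \<eta> eps exponents in auto)
  \<comment> \<open>\<open>\<Phi>\<close> is measurable only on
    \<open>X\<epsilon> \<times> UNIV\<close>; extension by zero gives a globally Borel map, and the
    iterates never leave the region of agreement once the perturbations obey their bounds.\<close>
  define \<Phi>' where "\<Phi>' x y = indicator (X\<epsilon> \<times> UNIV) (x, y) *\<^sub>R \<Phi> x y" for x y
  have \<Phi>'_eq: "\<Phi>' x y = \<Phi> x y" if "x \<in> X\<epsilon>" for x y using that by (simp add: \<Phi>'_def)
  have closed_X\<epsilon>: "closed X\<epsilon>"
    unfolding X\<epsilon> by (rule compact_imp_closed[OF rs.compact_shifted])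
  have \<Phi>'_meas: "(\<lambda>(x, y). \<Phi>' x y) \<in> borel_measurable (borel \<Otimes>\<^sub>M borel)"
  proof -
    have "X\<epsilon> \<times> UNIV \<in> sets (borel \<Otimes>\<^sub>M (borel :: (real ^ 'd) measure))"
      using closed_X\<epsilon> by (intro pair_measureI) auto
    then have "(\<lambda>p. indicator (X\<epsilon> \<times> UNIV) p *\<^sub>R (\<lambda>(x, y). \<Phi> x y) p) \<in> borel_measurable (borel \<Otimes>\<^sub>M borel)"
      using \<Phi> by (subst (asm) borel_measurable_restrict_space_iff) auto
    then show ?thesis by (simp add: \<Phi>'_def case_prod_beta')
  qed
  note [measurable] = \<xi> \<Phi>'_meas
  have xi_meas [measurable]: "xi k \<in> borel_measurable M" for k
    using xi_indep by (auto simp: indep_vars_def)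
  have z_meas [measurable]: "z k \<in> borel_measurable M" for k
    using z_indep by (auto simp: indep_vars_def)
  have x0_meas [measurable]: "x0 \<in> borel_measurable M"
    using indep by (simp add: indep_vars3_def)
  have \<Phi>'_x [measurable]: "\<Phi>' x \<in> borel_measurable borel" for x
    using measurable_compose[OF measurable_Pair1'[of x] \<Phi>'_meas] by simp
  \<comment> \<open>Moments and means depend only on the law, which each \<open>xi k\<close> shares
    with \<open>\<xi>\<close>.\<close>
  have transfer: "integrable M (\<lambda>\<omega>. (norm (\<Phi>' x (xi k \<omega>)))\<^sup>2)"
      "(\<integral>\<omega>. (norm (\<Phi>' x (xi k \<omega>)))\<^sup>2 \<partial>M) \<le> C\<^sup>2" "(\<integral>\<omega>. \<Phi>' x (xi k \<omega>) \<partial>M) = F x"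
    if x: "x \<in> X\<epsilon>" for x k
  proof -
    have m: "(\<lambda>y. (norm (\<Phi>' x y))\<^sup>2) \<in> borel_measurable borel" by measurable
    show "integrable M (\<lambda>\<omega>. (norm (\<Phi>' x (xi k \<omega>)))\<^sup>2)"
      using moment(2)[OF x] integrable_distr_eq[OF xi_meas[of k] m] integrable_distr_eq[OF \<xi> m]
      by (simp add: xi_distr \<Phi>'_eq[OF x])
    show "(\<integral>\<omega>. (norm (\<Phi>' x (xi k \<omega>)))\<^sup>2 \<partial>M) \<le> C\<^sup>2"
      using moment(3)[OF x] integral_distr[OF xi_meas[of k] m] integral_distr[OF \<xi> m]
      by (simp add: xi_distr \<Phi>'_eq[OF x])
    show "(\<integral>\<omega>. \<Phi>' x (xi k \<omega>) \<partial>M) = F x"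
      using F[OF x] integral_distr[OF xi_meas[of k] \<Phi>'_x[of x]] integral_distr[OF \<xi> \<Phi>'_x[of x]]
      by (simp add: xi_distr \<Phi>'_eq[OF x])
  qed
  define N1 where "N1 = (borel :: (real ^ 'n) measure) \<Otimes>\<^sub>M Pi\<^sub>M (UNIV :: nat set) (\<lambda>_. borel :: (real ^ 'n) measure)"
  define N2 where "N2 = Pi\<^sub>M (UNIV :: nat set) (\<lambda>_. borel :: (real ^ 'd) measure)"
  define W where "W \<omega> = (x0 \<omega>, \<lambda>i. z i \<omega>)" for \<omega>
  define \<Xi> where "\<Xi> \<omega> = (\<lambda>j. xi j \<omega>)" for \<omega>
  have [measurable]: "W \<in> measurable M N1" "\<Xi> \<in> measurable M N2"
    unfolding W_def N1_def \<Xi>_def N2_def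
    by (intro measurable_Pair x0_meas measurable_PiM_single' z_meas xi_meas; simp)+
  have W\<Xi>: "distr M N1 W \<Otimes>\<^sub>M distr M N2 \<Xi> = distr M (N1 \<Otimes>\<^sub>M N2) (\<lambda>\<omega>. (W \<omega>, \<Xi> \<omega>))"
    unfolding W_def N1_def \<Xi>_def N2_def by (rule indep_vars3_distr_pair[OF indep])
  interpret PW: prob_space "distr M N1 W" by (rule prob_space_distr) measurable
  interpret P\<Xi>: prob_space "distr M N2 \<Xi>" by (rule prob_space_distr) measurable
  interpret W\<Xi>: pair_prob_space "distr M N1 W" "distr M N2 \<Xi>" ..
  \<comment> \<open>The conditions on the initial point and the perturbations are premises inside
    \<open>Q\<close>, so that the claim can be shown for every frozen value \<open>w\<close>,
    vacuously for the inadmissible ones.\<close>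
  define Q where "Q p \<longleftrightarrow> (case p of ((u, v), e) \<Rightarrow> u \<in> X \<longrightarrow> (\<forall>k. norm (v k) \<le> eps k) \<longrightarrow>
      arssa_iterate X \<Phi>' \<gamma> \<eta> u v e \<longlonglongrightarrow> tstar)" for p
  have Q_meas [measurable]: "Measurable.pred (N1 \<Otimes>\<^sub>M N2) Q"
  proof -
    have u: "(\<lambda>p. fst (fst p)) \<in> borel_measurable (N1 \<Otimes>\<^sub>M N2)" unfolding N1_def by measurable
    have v: "(\<lambda>p. snd (fst p) k) \<in> borel_measurable (N1 \<Otimes>\<^sub>M N2)" for k unfolding N1_def by measurable
    have e: "(\<lambda>p. snd p k) \<in> borel_measurable (N1 \<Otimes>\<^sub>M N2)" for k unfolding N2_def by measurable
    have it: "(\<lambda>p. arssa_iterate X \<Phi>' \<gamma> \<eta> (fst (fst p)) (\<lambda>i. snd (fst p) i) (\<lambda>i. snd p i) k)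
        \<in> borel_measurable (N1 \<Otimes>\<^sub>M N2)" for k
      using rs.tstar_in by (intro borel_measurable_arssa_iterate X \<Phi>'_meas u v e) auto
    note [measurable] = u v pred_tendsto[OF it] borel_closed[OF X(1)]
    show ?thesis unfolding Q_def case_prod_beta' by measurable
  qed
  have "AE p in distr M N1 W \<Otimes>\<^sub>M distr M N2 \<Xi>. Q p"
  proof (rule W\<Xi>.AE_pair_measure)
    show "{p \<in> space (distr M N1 W \<Otimes>\<^sub>M distr M N2 \<Xi>). Q p} \<in> sets (distr M N1 W \<Otimes>\<^sub>M distr M N2 \<Xi>)"
      using Q_meas unfolding W\<Xi> pred_def by simp
    show "AE w in distr M N1 W. AE e in distr M N2 \<Xi>. Q (w, e)"
    proof (rule AE_I2)
      fix w assume w: "w \<in> space (distr M N1 W)"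
      have *: "{e \<in> space N2. Q (w, e)} \<in> sets N2"
        using measurable_compose[OF measurable_Pair1'[of w N1 N2] Q_meas] w by (simp add: pred_def)
      have "AE \<omega> in M. Q (w, \<Xi> \<omega>)"
      proof (cases "fst w \<in> X \<and> (\<forall>k. norm (snd w k) \<le> eps k)")
        case True
        then have "AE \<omega> in M. (\<lambda>k. arssa_iterate X \<Phi>' \<gamma> \<eta> (fst w) (snd w) (\<lambda>i. xi i \<omega>) k) \<longlonglongrightarrow> tstar"
          using transfer unfolding X\<epsilon> by (intro rs.AE_iterate_tendsto[OF M \<Phi>'_meas xi_indep, where C=C]) auto
        then show ?thesis by eventually_elim (simp add: Q_def \<Xi>_def case_prod_beta')
      qed (auto simp: Q_def case_prod_beta')
      then show "AE e in distr M N2 \<Xi>. Q (w, e)"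
        using * by (subst AE_distr_iff) auto
    qed
  qed
  then have "AE p in distr M (N1 \<Otimes>\<^sub>M N2) (\<lambda>\<omega>. (W \<omega>, \<Xi> \<omega>)). Q p" by (simp only: W\<Xi>)
  then have AE_Q: "AE \<omega> in M. Q (W \<omega>, \<Xi> \<omega>)" by (rule AE_distrD[rotated]) measurable
  have "AE \<omega> in M. norm (z k \<omega>) \<le> eps k" for k
  proof -
    have "AE x in distr M borel (z k). norm x \<le> eps k"
      unfolding z_distr by (rule AE_uniform_measureI) auto
    then show ?thesis by (rule AE_distrD[rotated]) measurable
  qed
  then have AE_z: "AE \<omega> in M. \<forall>k. norm (z k \<omega>) \<le> eps k" by (simp add: AE_all_countable)
  have w_pos: "0 < \<gamma> t powr r" for t using constants by (simp add: \<gamma>)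
  have w_sum: "filterlim (\<lambda>n. \<Sum>t<n. \<gamma> t powr r) at_top sequentially"
  proof (rule filterlim_partial_sums_at_top)
    have "\<gamma> t powr r = \<gamma>0 powr r * real (t + 1) powr (- (a * r))" for t
      using constants by (simp add: \<gamma> powr_mult powr_powr)
    \<comment> \<open>This is where \<open>r \<le> 1 / a\<close> enters: it keeps the total weight
      divergent.\<close>
    moreover have "- 1 \<le> - (a * r)" using exponents by (simp add: field_simps)
    ultimately show "\<not> summable (\<lambda>t. \<gamma> t powr r)"
      using not_summable_powr_ge[of "- (a * r)"] constants
        summable_cmult_iff[of "\<gamma>0 powr r" "\<lambda>t. real (t + 1) powr (- (a * r))"] by simp
  qed simp
  show ?thesis
    using AE_Q AE_z AE_space
  proof eventually_elim
    case (elim \<omega>)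
    have "arssa_iterate X \<Phi>' \<gamma> \<eta> (x0 \<omega>) (\<lambda>i. z i \<omega>) (\<lambda>j. xi j \<omega>) \<longlonglongrightarrow> tstar"
      using elim x0(1) by (simp add: Q_def W_def \<Xi>_def)
    moreover have "arssa_iterate X \<Phi> \<gamma> \<eta> (x0 \<omega>) (\<lambda>i. z i \<omega>) (\<lambda>j. xi j \<omega>) k =
        arssa_iterate X \<Phi>' \<gamma> \<eta> (x0 \<omega>) (\<lambda>i. z i \<omega>) (\<lambda>j. xi j \<omega>) k" for k
    proof (rule arssa_iterate_cong[OF _ X(1) x0(1)[OF elim(3)]])
      show "\<Phi> (x + z i \<omega>) (xi i \<omega>) = \<Phi>' (x + z i \<omega>) (xi i \<omega>)" if "x \<in> X" for i x
        using rs.shift_in[OF that order_trans[OF elim(2)[rule_format] eps_bound(2)]]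
        by (simp add: \<Phi>'_eq X\<epsilon>)
    qed
    ultimately show ?case
      unfolding arssa_average_def by (intro weighted_average_tendsto[OF w_pos w_sum]) presburger
  qed
qed

end
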